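(* Let $Y=(Y_1,\dots,Y_n)^\top$ be a centered nondegenerate Gaussian vector with correlation matrix $R$, let $\mu\in\mathbb R^n$, and set $\sigma_i=\sqrt{\mathrm{Var}\,Y_i}$ and $\tilde\mu_i=\mu_i/\sigma_i$ for $i=1,\dots,n$, $\tilde\mu=(\tilde\mu_1,\dots,\tilde\mu_n)^\top$. Assume that $Z$ is a positive random variable, independent of $Y$, with density $\rho$ satisfying $$\rho(s)=e^{-\theta s+o(s)},\qquad s\to\infty,$$ with $\theta>0$. Let $X=\sqrt Z\,Y+Z\mu$. Then: 1. For $i=1,\dots,n$, $$\ln\Pr[X_i\le x]\sim\frac{2\theta}{\sqrt{2\theta\sigma_i^2+\mu_i^2}-\mu_i}\,x,\qquad x\to-\infty.$$ 2. The copula of $X$ has weak lower tail dependence function $$\chi(\lambda_1,\dots,\lambda_n)=\max_i\lambda_i\ \min_{v}\Big\{\sqrt{2\theta\,v^\top Rv+(\tilde\mu^\top v)^2}-\tilde\mu^\top v\Big\},$$ where the minimum is taken over the set $$\Big\{v\in\mathbb R^n:\ v_i\ge0,\ i=1,\dots,n,\ \sum_{i=1}^nv_i\lambda_i\big(\sqrt{2\theta+\tilde\mu_i^2}-\tilde\mu_i\big)=1\Big\}.$$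
   Context: Nondegenerate means that the covariance matrix of $Y$ is invertible. $f\sim g$ means $f/g\to1$ in the indicated limit. The copula of $X$ (which has continuous margins) is the function $C:[0,1]^n\to[0,1]$ with $\Pr[X_1\le x_1,\dots,X_n\le x_n]=C(\Pr[X_1\le x_1],\dots,\Pr[X_n\le x_n])$ for all $(x_1,\dots,x_n)\in\mathbb R^n$. The weak lower tail dependence function of a copula $C$ is defined by $$\chi(\lambda_1,\dots,\lambda_n)=\lim_{u\to0}\frac{\min_i\ln u^{\lambda_i}}{\ln C(u^{\lambda_1},\dots,u^{\lambda_n})},$$ whenever the limit exists for all $\lambda_1,\dots,\lambda_n\ge0$ such that $\lambda_k>0$ for at least one $k$ (a value $C=0$ in the denominator is read as giving the quotient $0$).
   Formalization: In part 2 the minimum is taken with the extra condition that v_i = 0 whenever λ_i = 0; without it the formula fails on the boundary, e.g. n = 2, μ = 0, negative correlation r, λ = (1,0), where χ = 1 but the printed minimum is √(1−r²). *)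

theory Defs
  imports "HOL-Probability.Probability" "HOL-Library.Landau_Symbols"
begin

text \<open>Gaussian vectors, possibly degenerate, as affine images (in law) of a vector of
  independent standard normals. A square matrix is enough: every covariance matrix
  has a square root.\<close>

definition gaussian_vector :: "'a measure \<Rightarrow> ('a \<Rightarrow> real ^ 'n) \<Rightarrow> bool" where
  "gaussian_vector M Y \<longleftrightarrow> Y \<in> borel_measurable M \<and>
     (\<exists>(A :: real ^ 'n ^ 'n) m.
        distr M borel Y =
        distr (\<Pi>\<^sub>M i\<in>UNIV. density lborel std_normal_density) borel
          (\<lambda>g. m + A *v (\<chi> i. g i)))"

definition covariance_matrix :: "'a measure \<Rightarrow> ('a \<Rightarrow> real ^ 'n) \<Rightarrow> real ^ 'n ^ 'n" where
  "covariance_matrix M Y = (\<chi> i j.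
     (LINT w|M. (Y w $ i - (LINT w'|M. Y w' $ i)) * (Y w $ j - (LINT w'|M. Y w' $ j))))"

definition correlation_matrix :: "'a measure \<Rightarrow> ('a \<Rightarrow> real ^ 'n) \<Rightarrow> real ^ 'n ^ 'n" where
  "correlation_matrix M Y = (\<chi> i j. covariance_matrix M Y $ i $ j /
     (sqrt (covariance_matrix M Y $ i $ i) * sqrt (covariance_matrix M Y $ j $ j)))"

text \<open>Only the values of a copula on the unit cube matter.\<close>

definition copula :: "(real ^ 'n \<Rightarrow> real) \<Rightarrow> bool" where
  "copula C \<longleftrightarrow> (\<exists>N. prob_space N \<and> sets N = sets borel \<and>
     (\<forall>i. distr N borel (\<lambda>w. w $ i) = uniform_measure lborel {0..1}) \<and>
     (\<forall>u. (\<forall>i. 0 \<le> u $ i \<and> u $ i \<le> 1) \<longrightarrow> C u = measure N {w. \<forall>i. w $ i \<le> u $ i}))"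

text \<open>The first conjunct is not redundant: if a marginal distribution function
  omits the value 0 or 1, the second one leaves \<open>C\<close> undetermined on the
  corresponding face of the cube.\<close>

definition copula_of :: "'a measure \<Rightarrow> ('a \<Rightarrow> real ^ 'n) \<Rightarrow> (real ^ 'n \<Rightarrow> real) \<Rightarrow> bool" where
  "copula_of M X C \<longleftrightarrow> copula C \<and>
     (\<forall>x. measure M {w \<in> space M. \<forall>i. X w $ i \<le> x $ i} =
          C (\<chi> i. measure M {w \<in> space M. X w $ i \<le> x $ i}))"

definition tail_directions :: "(real ^ 'n) set" where
  "tail_directions = {l. (\<forall>i. 0 \<le> l $ i) \<and> (\<exists>k. 0 < l $ k)}"

text \<open>Values of \<open>chi\<close> outside \<open>tail_directions\<close> are irrelevant.\<close>

definition has_weak_lower_tail_dependence ::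
  "(real ^ 'n \<Rightarrow> real) \<Rightarrow> (real ^ 'n \<Rightarrow> real) \<Rightarrow> bool" where
  "has_weak_lower_tail_dependence C chi \<longleftrightarrow> (\<forall>l \<in> tail_directions.
     ((\<lambda>u. if C (\<chi> i. u powr (l $ i)) = 0 then 0
           else (MIN i. ln (u powr (l $ i))) / ln (C (\<chi> i. u powr (l $ i))))
       \<longlongrightarrow> chi l) (at_right 0))"

text \<open>The last condition is vacuous when all \<open>l $ i\<close> are positive. On the boundary it
  cannot be dropped. If \<open>l $ i = 0\<close>, then \<open>u powr (l $ i) = 1\<close> puts no constraint on
  component \<open>i\<close> and \<open>C\<close> reduces to the copula of the others. A free \<open>v $ i \<ge> 0\<close> would
  instead correspond to that component being at most \<open>0\<close>. For \<open>m = 0\<close>,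
  two components with correlation \<open>r < 0\<close> and \<open>l = (1, 0)\<close>, this would turn the true
  value \<open>1\<close> of the dependence function into \<open>sqrt (1 - r\<^sup>2)\<close>.\<close>

definition tail_weights :: "real \<Rightarrow> real ^ 'n \<Rightarrow> real ^ 'n \<Rightarrow> (real ^ 'n) set" where
  "tail_weights \<theta> m l = {v. (\<forall>i. 0 \<le> v $ i) \<and>
     (\<Sum>i\<in>UNIV. v $ i * l $ i * (sqrt (2 * \<theta> + (m $ i)\<^sup>2) - m $ i)) = 1 \<and>
     (\<forall>i. l $ i = 0 \<longrightarrow> v $ i = 0)}"

end

theory Submission
  imports Defs "HOL-Real_Asymp.Real_Asymp"
begin

text \<open>Write \<open>Y = A g\<close> with independent standard normals \<open>g\<close>. Conditioning on \<open>Z\<close> shows that the Laplace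
  transform of \<open>X\<close> at \<open>w\<close> is finite if \<open>|A\<^sup>T w|\<^sup>2 / 2 - w \<bullet> \<mu> < \<theta>\<close>, so Chernoff's inequality bounds
  the probability that \<open>X\<close> is at most \<open>- t y\<close> by \<open>exp (- t (w \<bullet> y))\<close> up to constants for
  every \<open>w \<ge> 0\<close> in that domain. Conversely, forcing \<open>Z\<close> near \<open>t s\<close> and \<open>g\<close> near \<open>sqrt t\<close> times a
  vector \<open>z\<close> costs \<open>exp (- t (\<theta> s + |z|\<^sup>2 / 2))\<close>. The two bounds agree at the optimum by convex
  duality. By homogeneity the dual problem, to maximise \<open>w \<bullet> y\<close>, amounts to minimising
  \<open>sqrt (2 \<theta> (v \<bullet> R v) + (m \<bullet> v)\<^sup>2) - m \<bullet> v\<close> over \<open>tail_weights\<close>, and the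
  first-order condition at the minimiser supplies the optimal \<open>s\<close> and \<open>z\<close>.
  A single margin is the case where \<open>tail_weights\<close> is a singleton; it turns the quantiles
  entering the copula into asymptotically linear functions of \<open>ln u\<close>.\<close>

subsection \<open>Standard Gaussian vectors\<close>

text \<open>The multiplier lies exactly on the level set where \<open>exponent\<close> equals
  \<theta>, and there the Laplace transform may be infinite. Chernoff's inequality is therefore
  applied to \<open>c *\<^sub>R w\<close> with \<open>c < 1\<close>, and the loss is removed by
  letting \<open>c\<close> tend to 1 after logarithms have been divided by \<open>t\<close>.
  Likewise the lower bound starts from a slightly overscaled point, where all inequalities are
  strict. Constants, prefactors and the o(s) in the density disappear at this logarithmic scale.

  The square root in the rate solves a quadratic equation. With q = |A^T w|^2 and p = w \<bullet>
  \<mu>, the positive number c for which \<open>exponent\<close> takes the value \<theta> at c w is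
  2 \<theta> / (sqrt (2 \<theta> q + p^2) - p). So \<open>tail_rate\<close> is, up to the scaling by
  standard deviations, 2 \<theta> times the gauge of the set where \<open>exponent\<close> is at
  most \<theta>. Maximising a linear form over that set is then the same as minimising the gauge on
  a hyperplane. The sign constraint on the multiplier is the reason why the first-order conditions
  are inequalities.\<close>

abbreviation std_normal :: "real measure" where
  "std_normal \<equiv> density lborel std_normal_density"

abbreviation std_gauss :: "('n::finite \<Rightarrow> real) measure" where
  "std_gauss \<equiv> \<Pi>\<^sub>M i\<in>UNIV. std_normal"

interpretation std_normal: prob_space std_normal
  by (rule prob_space_normal_density) simp

interpretation std_gauss: product_prob_space "\<lambda>_. std_normal" UNIV
  by unfold_locales

interpretation std_gauss_finite: finite_product_prob_space "\<lambda>_::'n::finite. std_normal" UNIV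
  by unfold_locales simp

lemma measurable_vec_lambda [measurable (raw)]:
  fixes f :: "'n::finite \<Rightarrow> 'a \<Rightarrow> real"
  assumes "\<And>i. f i \<in> borel_measurable N"
  shows "(\<lambda>x. \<chi> i. f i x) \<in> borel_measurable N"
  using assms by (subst borel_measurable_euclidean_space) (auto simp: Basis_vec_def inner_axis)

lemma measurable_vec_nth [measurable (raw)]:
  fixes f :: "'a \<Rightarrow> real ^ 'n"
  assumes "f \<in> borel_measurable N"
  shows "(\<lambda>x. f x $ i) \<in> borel_measurable N"
proof -
  have "(\<lambda>v::real^'n. v $ i) \<in> borel_measurable borel"
    by (intro borel_measurable_continuous_onI continuous_intros)
  from measurable_compose[OF assms this] show ?thesis .
qed

lemma measurable_matrix_vector_mult [measurable (raw)]:
  fixes f :: "'a \<Rightarrow> real ^ 'n" and A :: "real ^ 'n ^ 'm"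
  assumes [measurable]: "f \<in> borel_measurable N"
  shows "(\<lambda>x. A *v f x) \<in> borel_measurable N"
  unfolding matrix_vector_mult_def by measurable

lemma std_gauss_coord_measurable [measurable]:
  "(\<lambda>g. g i) \<in> borel_measurable (std_gauss :: ('n::finite \<Rightarrow> real) measure)"
  using measurable_component_singleton[of i UNIV "\<lambda>_::'n. std_normal"] by simp

text \<open>Exponential tilting: completing the square turns the tilted density into a constant
  times the normal density with mean \<open>c\<close>.\<close>

lemma nn_integral_std_normal_exp:
  "(\<integral>\<^sup>+x. ennreal (exp (c * x)) \<partial>std_normal) = ennreal (exp (c\<^sup>2 / 2))"
proof -
  have eq: "std_normal_density x * exp (c * x) = exp (c\<^sup>2 / 2) * normal_density c 1 x" for x
    by (simp add: normal_density_def exp_add[symmetric] power2_eq_square field_simps)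
  have "(\<integral>\<^sup>+x. ennreal (exp (c * x)) \<partial>std_normal)
      = (\<integral>\<^sup>+x. ennreal (exp (c\<^sup>2 / 2)) * ennreal (normal_density c 1 x) \<partial>lborel)"
    by (simp add: nn_integral_density ennreal_mult[symmetric] eq normal_density_nonneg)
  also have "\<dots> = ennreal (exp (c\<^sup>2 / 2)) * (\<integral>\<^sup>+x. ennreal (normal_density c 1 x) \<partial>lborel)"
    by (rule nn_integral_cmult) simp
  also have "(\<integral>\<^sup>+x. ennreal (normal_density c 1 x) \<partial>lborel) = 1"
    using integrable_normal_density[of 1 c]
    by (subst nn_integral_eq_integral) (auto simp: normal_density_nonneg)
  finally show ?thesis by simp
qed

lemma nn_integral_std_gauss_exp:
  fixes a :: "'n::finite \<Rightarrow> real"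
  shows "(\<integral>\<^sup>+g. ennreal (exp (\<Sum>i\<in>UNIV. a i * g i)) \<partial>std_gauss) = ennreal (exp ((\<Sum>i\<in>UNIV. (a i)\<^sup>2) / 2))"
proof -
  have "(\<integral>\<^sup>+g. ennreal (exp (\<Sum>i\<in>UNIV. a i * g i)) \<partial>std_gauss)
      = (\<integral>\<^sup>+g. (\<Prod>i\<in>UNIV. ennreal (exp (a i * g i))) \<partial>std_gauss)"
    by (simp add: exp_sum prod_ennreal)
  also have "\<dots> = (\<Prod>i\<in>UNIV. \<integral>\<^sup>+x. ennreal (exp (a i * x)) \<partial>std_normal)"
    by (rule std_gauss.product_nn_integral_prod) auto
  also have "\<dots> = ennreal (exp ((\<Sum>i\<in>UNIV. (a i)\<^sup>2) / 2))"
    by (simp add: nn_integral_std_normal_exp prod_ennreal exp_sum[symmetric] sum_divide_distrib)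
  finally show ?thesis .
qed

lemma std_normal_moments:
  "integrable std_normal (\<lambda>x. x)" "integrable std_normal (\<lambda>x. x\<^sup>2)"
  "(LINT x|std_normal. x) = 0" "(LINT x|std_normal. x\<^sup>2) = 1"
  using integrable_std_normal_moment[of 1] integrable_std_normal_moment[of 2]
    integral_std_normal_moment_odd[of 0] integral_std_normal_moment_even[of 1]
  by (simp_all add: integrable_real_density integral_real_density normal_density_nonneg)

lemma std_gauss_coord_moments:
  fixes i j :: "'n::finite"
  shows "integrable std_gauss (\<lambda>g. g i)" "(LINT g|std_gauss. g i) = 0"
    and "integrable std_gauss (\<lambda>g. g i * g j)"
    and "(LINT g|std_gauss. g i * g j) = of_bool (i = j)"
proof -
  \<comment> \<open>Padding with the constant 1 writes a single coordinate as a product over all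
    coordinates, so that its integral factorises. The function \<open>e\<close> below does the same
    for a product of two.\<close>
  define f where "f k = (\<lambda>x::real. if k = i then x else 1)" for k
  have f: "integrable std_normal (f k)" for k
    using std_normal_moments by (cases "k = i") (simp_all add: f_def)
  have fp: "(\<Prod>k\<in>UNIV. f k (g k)) = g i" for g
    by (simp add: f_def)
  show "integrable std_gauss (\<lambda>g. g i)"
    using std_gauss.product_integrable_prod[of UNIV f] f by (simp add: fp)
  show "(LINT g|std_gauss. g i) = 0"
  proof -
    have "(LINT x|std_normal. f i x) = 0"
      using std_normal_moments(3) by (simp add: f_def)
    then show ?thesis
      using std_gauss.product_integral_prod[of UNIV f] f by (auto simp: fp prod_zero_iff)
  qed
  define e where "e k = (\<lambda>x::real. (if k = i then x else 1) * (if k = j then x else 1))" for k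
  have e: "integrable std_normal (e k)" for k
    using std_normal_moments
    by (cases "k = i"; cases "k = j") (simp_all add: e_def power2_eq_square)
  have ep: "(\<Prod>k\<in>UNIV. e k (g k)) = g i * g j" for g
    by (simp add: e_def prod.distrib)
  show "integrable std_gauss (\<lambda>g. g i * g j)"
    using std_gauss.product_integrable_prod[of UNIV e] e by (simp add: ep)
  have "(LINT g|std_gauss. g i * g j) = (\<Prod>k\<in>UNIV. LINT x|std_normal. e k x)"
    using std_gauss.product_integral_prod[of UNIV e] e by (simp add: ep)
  also have "\<dots> = of_bool (i = j)"
  proof (cases "i = j")
    case True
    then show ?thesis
      using std_normal_moments(4) std_normal.prob_space
      by (intro trans[OF prod.neutral] ballI, case_tac "x = j") (simp_all add: e_def power2_eq_square)
  next
    case False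
    then have "(LINT x|std_normal. e i x) = 0"
      using std_normal_moments(3) by (simp add: e_def)
    then show ?thesis using False by (auto simp: prod_zero_iff)
  qed
  finally show "(LINT g|std_gauss. g i * g j) = of_bool (i = j)" .
qed

lemma std_gauss_hyperplane_null:
  fixes a :: "'n::finite \<Rightarrow> real"
  assumes "a k \<noteq> 0"
  shows "AE g in std_gauss. (\<Sum>i\<in>UNIV. a i * g i) \<noteq> c"
proof -
  \<comment> \<open>Coordinates with coefficient 0 are left out because each summand must be a
    normal variable with positive standard deviation. The sum is then normal too and has a density,
    hence no atoms.\<close>
  define I where "I = {i. a i \<noteq> 0}"
  have I: "finite I" "I \<noteq> {}" using assms by (auto simp: I_def)
  have "std_gauss.indep_vars (\<lambda>_. std_normal) (\<lambda>i g. g i) (UNIV :: 'n set)"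
    by (subst std_gauss.indep_vars_iff_distr_eq_PiM')
      (auto simp: restrict_def std_gauss.PiM_component distr_id2)
  from std_gauss.indep_vars_compose2[OF this, of "\<lambda>i x. a i * x" "\<lambda>_. borel"]
  have "std_gauss.indep_vars (\<lambda>_. borel) (\<lambda>i g. a i * g i) (UNIV :: 'n set)"
    by simp
  then have "std_gauss.indep_vars (\<lambda>_. borel) (\<lambda>i g. a i * g i) I"
    by (rule std_gauss.indep_vars_subset) simp
  moreover have "distributed std_gauss lborel (\<lambda>g. a i * g i) (normal_density 0 \<bar>a i\<bar>)" if "i \<in> I" for i
  proof -
    have "distr std_gauss std_normal (\<lambda>g. g i) = std_normal"
      by (rule std_gauss.PiM_component) simp
    also have "distr std_gauss std_normal (\<lambda>g. g i) = distr std_gauss lborel (\<lambda>g. g i)"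
      by (rule distr_cong) simp_all
    finally have "distributed std_gauss lborel (\<lambda>g. g i) (normal_density 0 1)"
      by (simp add: distributed_def)
    from std_gauss.normal_density_affine[OF this, of "a i" 0] that show ?thesis
      by (simp add: I_def)
  qed
  ultimately have "distributed std_gauss lborel (\<lambda>g. \<Sum>i\<in>I. a i * g i)
      (normal_density (\<Sum>i\<in>I. 0) (sqrt (\<Sum>i\<in>I. \<bar>a i\<bar>\<^sup>2)))"
    using I by (intro std_gauss.sum_indep_normal) (auto simp: I_def)
  then have D: "distr std_gauss lborel (\<lambda>g. \<Sum>i\<in>I. a i * g i)
     = density lborel (normal_density 0 (sqrt (\<Sum>i\<in>I. \<bar>a i\<bar>\<^sup>2)))"
    by (simp add: distributed_def)
  have "AE x in density lborel (normal_density 0 (sqrt (\<Sum>i\<in>I. \<bar>a i\<bar>\<^sup>2))). x \<noteq> c"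
    using AE_lborel_singleton[of c] by (auto simp: AE_density elim: eventually_mono)
  then have "AE g in std_gauss. (\<Sum>i\<in>I. a i * g i) \<noteq> c"
    unfolding D[symmetric] by (subst (asm) AE_distr_iff) auto
  moreover have "(\<Sum>i\<in>I. a i * g i) = (\<Sum>i\<in>UNIV. a i * g i)" for g
    by (rule sum.mono_neutral_left) (auto simp: I_def)
  ultimately show ?thesis by simp
qed

section \<open>Lower bounds for Gaussian boxes at scale \<open>sqrt t\<close>\<close>

lemma emeasure_density_Icc_ge:
  fixes f :: "real \<Rightarrow> real"
  assumes "(\<lambda>x. ennreal (f x)) \<in> borel_measurable lborel" "a \<le> b" "0 \<le> m"
    and "\<And>x. x \<in> {a..b} \<Longrightarrow> m \<le> f x"
  shows "ennreal (m * (b - a)) \<le> emeasure (density lborel (\<lambda>x. ennreal (f x))) {a..b}"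
proof -
  have "ennreal (m * (b - a)) = (\<integral>\<^sup>+x. ennreal m * indicator {a..b} x \<partial>lborel)"
    using assms by (simp add: nn_integral_cmult_indicator ennreal_mult)
  also have "\<dots> \<le> (\<integral>\<^sup>+x. ennreal (f x) * indicator {a..b} x \<partial>lborel)"
    using assms(4) by (intro nn_integral_mono) (auto simp: indicator_def intro: ennreal_leI)
  also have "\<dots> = emeasure (density lborel (\<lambda>x. ennreal (f x))) {a..b}"
    using assms(1) by (simp add: emeasure_density)
  finally show ?thesis .
qed

lemma std_normal_scaled_interval_ge:
  fixes z \<delta> \<epsilon> :: real
  assumes "0 < \<delta>" "0 < \<epsilon>"
  shows "\<forall>\<^sub>F t in at_top. exp (- t * (z\<^sup>2 / 2 + \<epsilon>)) \<le>
    measure std_normal {sqrt t * (z - \<delta>)..sqrt t * (z + \<delta>)}"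
proof -
  \<comment> \<open>A smaller half-width \<open>d\<close> is chosen so that even the worst point of
    the interval costs less than \<open>z\<^sup>2 / 2 + \<epsilon>\<close>.\<close>
  have "((\<lambda>d. (\<bar>z\<bar> + d)\<^sup>2 / 2) \<longlongrightarrow> (\<bar>z\<bar> + 0)\<^sup>2 / 2) (at_right 0)"
    by (intro tendsto_intros) simp
  from order_tendstoD(2)[OF this, of "z\<^sup>2 / 2 + \<epsilon>"]
  have "\<forall>\<^sub>F d in at_right 0. (\<bar>z\<bar> + d)\<^sup>2 / 2 < z\<^sup>2 / 2 + \<epsilon>"
    using assms by simp
  moreover have "\<forall>\<^sub>F d in at_right (0::real). 0 < d \<and> d < \<delta>"
    using assms eventually_at_right_real[of 0 \<delta>] by simp
  ultimately have "\<forall>\<^sub>F d in at_right (0::real). (\<bar>z\<bar> + d)\<^sup>2 / 2 < z\<^sup>2 / 2 + \<epsilon> \<and> 0 < d \<and> d < \<delta>"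
    by eventually_elim simp
  then obtain d where d: "(\<bar>z\<bar> + d)\<^sup>2 / 2 < z\<^sup>2 / 2 + \<epsilon>" "0 < d" "d < \<delta>"
    using eventually_happens[of _ "at_right (0::real)"] by auto
  have "filterlim (\<lambda>t. 2 * d * sqrt t / sqrt (2 * pi)) at_top at_top"
    using d by real_asymp
  then have "\<forall>\<^sub>F t in at_top. 1 \<le> 2 * d * sqrt t / sqrt (2 * pi)"
    unfolding filterlim_at_top by blast
  then show ?thesis
    using eventually_gt_at_top[of 0]
  proof eventually_elim
    case (elim t)
    define I where "I = {sqrt t * (z - d)..sqrt t * (z + d)}"
    define m where "m = exp (- t * ((\<bar>z\<bar> + d)\<^sup>2 / 2)) / sqrt (2 * pi)"
    have low: "m \<le> std_normal_density x" if "x \<in> I" for x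
    proof -
      from that have "x \<le> sqrt t * (z + d)" "- x \<le> sqrt t * (d - z)"
        by (auto simp: I_def algebra_simps)
      moreover have "sqrt t * (z + d) \<le> sqrt t * (\<bar>z\<bar> + d)" "sqrt t * (d - z) \<le> sqrt t * (\<bar>z\<bar> + d)"
        using elim by (intro mult_left_mono; simp)+
      ultimately have "\<bar>x\<bar> \<le> sqrt t * (\<bar>z\<bar> + d)" by linarith
      then have "\<bar>x\<bar>\<^sup>2 \<le> (sqrt t * (\<bar>z\<bar> + d))\<^sup>2" by (intro power_mono) auto
      then have "x\<^sup>2 \<le> t * (\<bar>z\<bar> + d)\<^sup>2" using elim by (simp add: power_mult_distrib)
      then show ?thesis unfolding m_def normal_density_def by (simp add: divide_right_mono)
    qed
    have "exp (- t * (z\<^sup>2 / 2 + \<epsilon>)) \<le> exp (- t * ((\<bar>z\<bar> + d)\<^sup>2 / 2))"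
      using d elim by simp
    also have "\<dots> \<le> exp (- t * ((\<bar>z\<bar> + d)\<^sup>2 / 2)) * (2 * d * sqrt t / sqrt (2 * pi))"
      using mult_left_mono[OF elim(1), of "exp (- t * ((\<bar>z\<bar> + d)\<^sup>2 / 2))"] by simp
    also have "\<dots> = m * (sqrt t * (z + d) - sqrt t * (z - d))"
      by (simp add: m_def algebra_simps)
    also have "\<dots> \<le> measure std_normal I"
      using emeasure_density_Icc_ge[of std_normal_density "sqrt t * (z - d)" "sqrt t * (z + d)" m]
        low elim d unfolding I_def[symmetric] std_normal.emeasure_eq_measure
      by (auto simp: m_def)
    also have "\<dots> \<le> measure std_normal {sqrt t * (z - \<delta>)..sqrt t * (z + \<delta>)}"
    proof (intro std_normal.finite_measure_mono)
      have "sqrt t * (z - \<delta>) \<le> sqrt t * (z - d)" "sqrt t * (z + d) \<le> sqrt t * (z + \<delta>)"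
        using d elim by (intro mult_left_mono; simp)+
      then show "I \<subseteq> {sqrt t * (z - \<delta>)..sqrt t * (z + \<delta>)}" by (auto simp: I_def)
    qed simp
    finally show ?case .
  qed
qed

lemma std_gauss_scaled_box_ge:
  fixes z :: "'n::finite \<Rightarrow> real"
  assumes "0 < \<delta>" "0 < \<epsilon>"
  shows "\<forall>\<^sub>F t in at_top. exp (- t * ((\<Sum>i\<in>UNIV. (z i)\<^sup>2) / 2 + \<epsilon>)) \<le>
    measure std_gauss (\<Pi>\<^sub>E i\<in>UNIV. {sqrt t * (z i - \<delta>)..sqrt t * (z i + \<delta>)})"
proof -
  \<comment> \<open>The error is shared equally among the independent coordinates.\<close>
  define e where "e = \<epsilon> / CARD('n)"
  have "0 < e" using assms by (simp add: e_def)
  then have "\<forall>\<^sub>F t in at_top. \<forall>i\<in>(UNIV::'n set). exp (- t * ((z i)\<^sup>2 / 2 + e)) \<le>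
    measure std_normal {sqrt t * (z i - \<delta>)..sqrt t * (z i + \<delta>)}"
    using assms by (intro eventually_ball_finite ballI std_normal_scaled_interval_ge) auto
  then show ?thesis
  proof eventually_elim
    case (elim t)
    have "(\<Sum>i\<in>(UNIV::'n set). (z i)\<^sup>2 / 2 + e) = (\<Sum>i\<in>UNIV. (z i)\<^sup>2) / 2 + \<epsilon>"
      by (simp add: sum.distrib sum_divide_distrib[symmetric] e_def)
    then have "exp (- t * ((\<Sum>i\<in>UNIV. (z i)\<^sup>2) / 2 + \<epsilon>)) = (\<Prod>i\<in>(UNIV::'n set). exp (- t * ((z i)\<^sup>2 / 2 + e)))"
      by (simp only: exp_sum[symmetric] finite sum_distrib_left[symmetric])
    also have "\<dots> \<le> (\<Prod>i\<in>(UNIV::'n set). measure std_normal {sqrt t * (z i - \<delta>)..sqrt t * (z i + \<delta>)})"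
      using elim by (intro prod_mono) auto
    also have "\<dots> = measure std_gauss (\<Pi>\<^sub>E i\<in>UNIV. {sqrt t * (z i - \<delta>)..sqrt t * (z i + \<delta>)})"
      by (rule std_gauss_finite.finite_measure_PiM_emb[symmetric]) simp
    finally show ?case .
  qed
qed

subsection \<open>Large deviations of normal mixtures\<close>

text \<open>The o(s) in the exponent of the density enters as a pair of one-sided bounds: the upper
  one controls the Laplace transform of \<open>Z\<close>, the lower one the probability that
  \<open>Z\<close> is near a large value.\<close>

locale normal_mixture = prob_space M
  for M :: "'a measure" +
  fixes Y :: "'a \<Rightarrow> real ^ 'n" and Z :: "'a \<Rightarrow> real"
    and A :: "real ^ 'n ^ 'n" and \<mu> :: "real ^ 'n"
    and \<rho> :: "real \<Rightarrow> real" and \<theta> :: real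
  assumes Y_measurable [measurable]: "Y \<in> borel_measurable M"
    and Y_distr: "distr M borel Y = distr std_gauss borel (\<lambda>g. A *v (\<chi> i. g i))"
    and indep: "indep_set (sets (vimage_algebra (space M) Z borel)) (sets (vimage_algebra (space M) Y borel))"
    and Z_pos: "AE \<omega> in M. 0 < Z \<omega>"
    and Z_distr: "distributed M lborel Z (\<lambda>s. ennreal (\<rho> s))"
    and \<rho>_nonneg: "0 \<le> \<rho> s"
    and \<theta>_pos: "0 < \<theta>"
    and \<rho>_lower: "0 < \<epsilon> \<Longrightarrow> \<forall>\<^sub>F s in at_top. exp (- (\<theta> + \<epsilon>) * s) \<le> \<rho> s"
    and \<rho>_upper: "0 < \<epsilon> \<Longrightarrow> \<forall>\<^sub>F s in at_top. \<rho> s \<le> exp (- (\<theta> - \<epsilon>) * s)"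
begin

definition X :: "'a \<Rightarrow> real ^ 'n" where
  "X \<omega> = sqrt (Z \<omega>) *\<^sub>R Y \<omega> + Z \<omega> *\<^sub>R \<mu>"

text \<open>The index set \<open>S\<close> will collect the components with
  \<open>l $ i > 0\<close>. A component with \<open>l $ i = 0\<close> has copula argument 1 and must
  stay unconstrained.\<close>

definition orthant :: "'n set \<Rightarrow> ('n \<Rightarrow> real) \<Rightarrow> 'a set" where
  "orthant S x = {\<omega> \<in> space M. \<forall>i\<in>S. X \<omega> $ i \<le> x i}"

text \<open>Given \<open>Z = s\<close>, the logarithm of the Laplace transform of \<open>X\<close>
  at \<open>w\<close> is \<open>s * exponent w\<close>.\<close>

definition exponent :: "real ^ 'n \<Rightarrow> real" where
  "exponent w = (norm (transpose A *v w))\<^sup>2 / 2 - w \<bullet> \<mu>"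

section \<open>Joint law of \<open>Z\<close> and \<open>Y\<close>, and Laplace transforms\<close>

lemma Z_measurable [measurable]: "Z \<in> borel_measurable M"
  using Z_distr by (simp add: distributed_def)

lemma prob_ZY:
  assumes "I \<in> sets borel" "B \<in> sets borel"
  shows "prob ((\<lambda>\<omega>. (Z \<omega>, Y \<omega>)) -` (I \<times> B) \<inter> space M) = prob (Z -` I \<inter> space M) * prob (Y -` B \<inter> space M)"
proof -
  have "prob ((Z -` I \<inter> space M) \<inter> (Y -` B \<inter> space M)) = prob (Z -` I \<inter> space M) * prob (Y -` B \<inter> space M)"
    using assms by (intro indep_setD[OF indep] in_vimage_algebra)
  moreover have "(\<lambda>\<omega>. (Z \<omega>, Y \<omega>)) -` (I \<times> B) \<inter> space M = (Z -` I \<inter> space M) \<inter> (Y -` B \<inter> space M)"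
    by auto
  ultimately show ?thesis by simp
qed

lemma distr_ZY: "distr M borel Z \<Otimes>\<^sub>M distr M borel Y = distr M (borel \<Otimes>\<^sub>M borel) (\<lambda>\<omega>. (Z \<omega>, Y \<omega>))"
proof (rule pair_measure_eqI)
  show "sigma_finite_measure (distr M borel Z)" "sigma_finite_measure (distr M borel Y)"
    by (intro prob_space_imp_sigma_finite prob_space_distr; simp)+
  show "sets (distr M borel Z \<Otimes>\<^sub>M distr M borel Y) = sets (distr M (borel \<Otimes>\<^sub>M borel) (\<lambda>\<omega>. (Z \<omega>, Y \<omega>)))"
    unfolding sets_distr by (rule sets_pair_measure_cong) simp_all
  fix I B assume "I \<in> sets (distr M borel Z)" "B \<in> sets (distr M borel Y)"
  then have IB: "I \<in> sets borel" "B \<in> sets borel" by simp_all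
  then show "emeasure (distr M borel Z) I * emeasure (distr M borel Y) B
      = emeasure (distr M (borel \<Otimes>\<^sub>M borel) (\<lambda>\<omega>. (Z \<omega>, Y \<omega>))) (I \<times> B)"
    using prob_ZY[OF IB] by (simp add: emeasure_distr emeasure_eq_measure ennreal_mult[symmetric])
qed

lemma X_measurable [measurable]: "X \<in> borel_measurable M"
  unfolding X_def by measurable

lemma orthant_sets [measurable]: "orthant S x \<in> events"
  unfolding orthant_def by measurable

lemma \<rho>_measurable: "(\<lambda>s. ennreal (\<rho> s)) \<in> borel_measurable lborel"
  using Z_distr by (simp add: distributed_def)

lemma distr_Z: "distr M borel Z = density lborel (\<lambda>s. ennreal (\<rho> s))"
proof -
  have "distr M borel Z = distr M lborel Z" by (rule distr_cong) simp_all
  then show ?thesis using Z_distr by (simp add: distributed_def)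
qed

lemma transpose_mult_scaleR: "transpose A *v (c *\<^sub>R w) = c *\<^sub>R (transpose A *v w)"
  by (rule matrix_vector_mult_scaleR)

lemma Y_laplace: "(\<integral>\<^sup>+y. ennreal (exp (u \<bullet> y)) \<partial>distr M borel Y) = ennreal (exp ((norm (transpose A *v u))\<^sup>2 / 2))"
proof -
  let ?a = "\<lambda>j. (transpose A *v u) $ j"
  have eq: "u \<bullet> (A *v (\<chi> i. g i)) = (\<Sum>j\<in>UNIV. ?a j * g j)" for g :: "'n \<Rightarrow> real"
  proof -
    have "u \<bullet> (A *v (\<chi> i. g i)) = (transpose A *v u) \<bullet> (\<chi> i. g i)"
      by (metis dot_lmul_matrix vector_transpose_matrix transpose_transpose)
    then show ?thesis by (simp add: inner_vec_def)
  qed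
  have "(\<integral>\<^sup>+y. ennreal (exp (u \<bullet> y)) \<partial>distr M borel Y)
      = (\<integral>\<^sup>+g. ennreal (exp (\<Sum>j\<in>UNIV. ?a j * g j)) \<partial>std_gauss)"
    unfolding Y_distr by (subst nn_integral_distr) (simp_all add: eq)
  also have "\<dots> = ennreal (exp ((\<Sum>j\<in>UNIV. (?a j)\<^sup>2) / 2))"
    by (rule nn_integral_std_gauss_exp)
  also have "(\<Sum>j\<in>UNIV. (?a j)\<^sup>2) = (norm (transpose A *v u))\<^sup>2"
    by (simp add: norm_vec_def L2_set_def sum_nonneg)
  finally show ?thesis .
qed

lemma X_laplace: "(\<integral>\<^sup>+\<omega>. ennreal (exp (- (w \<bullet> X \<omega>))) \<partial>M) = (\<integral>\<^sup>+\<omega>. ennreal (exp (exponent w * Z \<omega>)) \<partial>M)"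
proof -
  let ?e = "\<lambda>s y. ennreal (exp (- (sqrt s * (w \<bullet> y) + s * (w \<bullet> \<mu>))))"
  interpret DY: prob_space "distr M borel Y" by (rule prob_space_distr) simp
  interpret DZ: prob_space "distr M borel Z" by (rule prob_space_distr) simp
  have inner: "(\<integral>\<^sup>+y. ?e s y \<partial>distr M borel Y) = ennreal (exp (exponent w * s))" if "0 < s" for s
  proof -
    have "(\<integral>\<^sup>+y. ?e s y \<partial>distr M borel Y)
      = (\<integral>\<^sup>+y. ennreal (exp (- (s * (w \<bullet> \<mu>)))) * ennreal (exp ((- sqrt s *\<^sub>R w) \<bullet> y)) \<partial>distr M borel Y)"
      by (simp add: ennreal_mult[symmetric] exp_add[symmetric] algebra_simps)
    also have "\<dots> = ennreal (exp (- (s * (w \<bullet> \<mu>)))) * ennreal (exp ((norm (transpose A *v (- sqrt s *\<^sub>R w)))\<^sup>2 / 2))"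
      by (subst nn_integral_cmult) (simp_all only: Y_laplace, measurable)
    also have "\<dots> = ennreal (exp (exponent w * s))"
    proof -
      \<comment> \<open>Positivity of \<open>s\<close> gives \<open>(sqrt s)\<^sup>2 = s\<close>.
        The variance term thereby becomes linear in \<open>s\<close> like the drift, and what
        remains is an exponential moment of \<open>Z\<close>.\<close>
      have "(norm (transpose A *v (- sqrt s *\<^sub>R w)))\<^sup>2 = s * (norm (transpose A *v w))\<^sup>2"
        using that by (simp only: transpose_mult_scaleR norm_scaleR power_mult_distrib) simp
      then show ?thesis
        by (simp add: ennreal_mult[symmetric] exp_add[symmetric] exponent_def algebra_simps)
    qed
    finally show ?thesis .
  qed
  have "(\<integral>\<^sup>+\<omega>. ennreal (exp (- (w \<bullet> X \<omega>))) \<partial>M) = (\<integral>\<^sup>+\<omega>. (case (Z \<omega>, Y \<omega>) of (s, y) \<Rightarrow> ?e s y) \<partial>M)"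
    by (simp add: X_def inner_add_right)
  also have "\<dots> = (\<integral>\<^sup>+p. (case p of (s, y) \<Rightarrow> ?e s y) \<partial>distr M (borel \<Otimes>\<^sub>M borel) (\<lambda>\<omega>. (Z \<omega>, Y \<omega>)))"
    by (subst nn_integral_distr) simp_all
  also have "\<dots> = (\<integral>\<^sup>+p. (case p of (s, y) \<Rightarrow> ?e s y) \<partial>(distr M borel Z \<Otimes>\<^sub>M distr M borel Y))"
    by (simp add: distr_ZY)
  also have "\<dots> = (\<integral>\<^sup>+s. \<integral>\<^sup>+y. ?e s y \<partial>distr M borel Y \<partial>distr M borel Z)"
    by (subst DY.nn_integral_fst[symmetric]) simp_all
  also have "\<dots> = (\<integral>\<^sup>+s. ennreal (exp (exponent w * s)) \<partial>distr M borel Z)"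
  proof (rule nn_integral_cong_AE)
    have "AE s in distr M borel Z. 0 < s" using Z_pos by (subst AE_distr_iff) auto
    then show "AE s in distr M borel Z. (\<integral>\<^sup>+y. ?e s y \<partial>distr M borel Y) = ennreal (exp (exponent w * s))"
      by eventually_elim (rule inner)
  qed
  also have "\<dots> = (\<integral>\<^sup>+\<omega>. ennreal (exp (exponent w * Z \<omega>)) \<partial>M)"
    by (subst nn_integral_distr) simp_all
  finally show ?thesis .
qed

lemma Z_laplace_finite:
  assumes "\<kappa> < \<theta>"
  shows "(\<integral>\<^sup>+\<omega>. ennreal (exp (\<kappa> * Z \<omega>)) \<partial>M) < \<infinity>"
proof -
  \<comment> \<open>Half the gap: beyond \<open>s0\<close> the tilted density is at most
    \<open>exp (- e * s)\<close>, because \<theta> - e - \<kappa> = e.\<close>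
  define e where "e = (\<theta> - \<kappa>) / 2"
  have e: "0 < e" using assms by (simp add: e_def)
  obtain s0 where s0: "\<And>s. s0 \<le> s \<Longrightarrow> \<rho> s \<le> exp (- (\<theta> - e) * s)"
    using \<rho>_upper[OF e] by (auto simp: eventually_at_top_linorder)
  define a where "a = max s0 0"
  \<comment> \<open>The first summand dominates on \<open>s < a\<close>, where the exponential
    factor is bounded; the second one equals \<open>exp (- e * s)\<close> for
    \<open>s \<ge> 0\<close>. Both are multiples of probability densities.\<close>
  let ?B = "\<lambda>s. ennreal (exp (\<bar>\<kappa>\<bar> * a)) * ennreal (\<rho> s) + ennreal (1 / e) * ennreal (exponential_density e s)"
  have "AE s in distr M borel Z. 0 < s" using Z_pos by (subst AE_distr_iff) auto
  then have pos: "AE s in lborel. 0 < ennreal (\<rho> s) \<longrightarrow> 0 < s"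
    unfolding distr_Z using \<rho>_measurable by (simp add: AE_density)
  have bound: "ennreal (\<rho> s) * ennreal (exp (\<kappa> * s)) \<le> ?B s" if "0 < ennreal (\<rho> s) \<longrightarrow> 0 < s" for s
  proof (cases "0 < \<rho> s \<and> a \<le> s")
    case True
    then have "\<rho> s * exp (\<kappa> * s) \<le> exp (- (\<theta> - e) * s) * exp (\<kappa> * s)"
      by (intro mult_right_mono s0) (auto simp: a_def)
    also have "\<dots> = 1 / e * exponential_density e s"
      using True e that by (simp add: exponential_density_def exp_add[symmetric] e_def field_simps)
    finally have "ennreal (\<rho> s) * ennreal (exp (\<kappa> * s)) \<le> ennreal (1 / e) * ennreal (exponential_density e s)"
      using e by (simp add: ennreal_mult[symmetric] \<rho>_nonneg exponential_density_nonneg)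
    then show ?thesis by (simp add: add_increasing)
  next
    case False
    show ?thesis
    proof (cases "\<rho> s = 0")
      case f: False
      then have s: "0 < s" "s < a" using False that \<rho>_nonneg[of s] by auto
      then have "\<kappa> * s \<le> \<bar>\<kappa>\<bar> * a"
        by (intro mult_mono) auto
      then have "\<rho> s * exp (\<kappa> * s) \<le> exp (\<bar>\<kappa>\<bar> * a) * \<rho> s"
        using \<rho>_nonneg[of s] mult_left_mono[of "exp (\<kappa> * s)" "exp (\<bar>\<kappa>\<bar> * a)" "\<rho> s"] by (simp add: mult.commute)
      then have "ennreal (\<rho> s) * ennreal (exp (\<kappa> * s)) \<le> ennreal (exp (\<bar>\<kappa>\<bar> * a)) * ennreal (\<rho> s)"
        by (simp add: ennreal_mult[symmetric] \<rho>_nonneg)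
      then show ?thesis by (simp add: add_increasing2)
    qed simp
  qed
  have "(\<integral>\<^sup>+\<omega>. ennreal (exp (\<kappa> * Z \<omega>)) \<partial>M) = (\<integral>\<^sup>+s. ennreal (exp (\<kappa> * s)) \<partial>distr M borel Z)"
    by (subst nn_integral_distr) simp_all
  also have "\<dots> = (\<integral>\<^sup>+s. ennreal (\<rho> s) * ennreal (exp (\<kappa> * s)) \<partial>lborel)"
    unfolding distr_Z using \<rho>_measurable by (subst nn_integral_density) simp_all
  also have "\<dots> \<le> (\<integral>\<^sup>+s. ?B s \<partial>lborel)"
    using pos bound by (intro nn_integral_mono_AE) (auto elim: eventually_mono)
  also have "\<dots> = ennreal (exp (\<bar>\<kappa>\<bar> * a)) * (\<integral>\<^sup>+s. ennreal (\<rho> s) \<partial>lborel)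
      + ennreal (1 / e) * (\<integral>\<^sup>+s. ennreal (exponential_density e s) \<partial>lborel)"
    using \<rho>_measurable by (subst nn_integral_add) (simp_all add: nn_integral_cmult)
  also have "(\<integral>\<^sup>+s. ennreal (exponential_density e s) \<partial>lborel) = 1"
    using prob_space.emeasure_space_1[OF prob_space_exponential_density[OF e]]
    by (simp add: emeasure_density)
  also have "(\<integral>\<^sup>+s. ennreal (\<rho> s) \<partial>lborel) = 1"
  proof -
    interpret DZ: prob_space "distr M borel Z" by (rule prob_space_distr) simp
    show ?thesis
      using DZ.emeasure_space_1 \<rho>_measurable unfolding distr_Z by (simp add: emeasure_density)
  qed
  finally show ?thesis by (rule order.strict_trans1) (simp add: ennreal_add_eq_top less_top[symmetric] ennreal_mult_eq_top_iff)
qed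

text \<open>Markov's inequality for the exponential of \<open>- (w \<bullet> X)\<close>, where
  \<open>w \<ge> 0\<close> makes the inner product monotone in the coordinates. It matters that
  \<open>K\<close> is fixed before \<open>x\<close>, so that \<open>ln K\<close> vanishes after
  division by \<open>t\<close>.\<close>

lemma orthant_chernoff:
  assumes "exponent w < \<theta>" "\<And>i. 0 \<le> w $ i" "\<And>i. i \<notin> S \<Longrightarrow> w $ i = 0"
  obtains K where "0 < K" "\<And>x. prob (orthant S x) \<le> K * exp (\<Sum>i\<in>S. w $ i * x i)"
proof -
  define L where "L = (\<integral>\<^sup>+\<omega>. ennreal (exp (- (w \<bullet> X \<omega>))) \<partial>M)"
  have L: "L < \<infinity>" unfolding L_def X_laplace by (rule Z_laplace_finite) fact
  \<comment> \<open>Adding 1 makes the constant positive without a separate argument for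
    \<open>L\<close>.\<close>
  have "prob (orthant S x) \<le> (enn2real L + 1) * exp (\<Sum>i\<in>S. w $ i * x i)" for x
  proof -
    let ?c = "\<Sum>i\<in>S. w $ i * x i"
    have "emeasure M (orthant S x) = (\<integral>\<^sup>+\<omega>. indicator (orthant S x) \<omega> \<partial>M)" by simp
    also have "\<dots> \<le> (\<integral>\<^sup>+\<omega>. ennreal (exp ?c) * ennreal (exp (- (w \<bullet> X \<omega>))) \<partial>M)"
    proof (rule nn_integral_mono)
      fix \<omega>
      show "indicator (orthant S x) \<omega> \<le> ennreal (exp ?c) * ennreal (exp (- (w \<bullet> X \<omega>)))"
      proof (cases "\<omega> \<in> orthant S x")
        case True
        have "w \<bullet> X \<omega> = (\<Sum>i\<in>S. w $ i * X \<omega> $ i)"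
          unfolding inner_vec_def inner_real_def using assms(3) by (intro sum.mono_neutral_right) auto
        also have "\<dots> \<le> ?c"
          using True assms(2) by (intro sum_mono mult_left_mono) (auto simp: orthant_def)
        finally show ?thesis using True
          by (simp add: ennreal_mult[symmetric] exp_add[symmetric] flip: ennreal_1)
      qed simp
    qed
    also have "\<dots> = ennreal (exp ?c) * L"
      unfolding L_def by (rule nn_integral_cmult) simp
    also have "\<dots> = ennreal (exp ?c * enn2real L)"
      using L by (simp add: ennreal_mult less_top)
    finally have "prob (orthant S x) \<le> exp ?c * enn2real L"
      unfolding emeasure_eq_measure by simp
    also have "\<dots> \<le> (enn2real L + 1) * exp ?c" by (simp add: algebra_simps)
    finally show ?thesis .
  qed
  then show thesis using that[of "enn2real L + 1"] by (simp add: add_nonneg_pos)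
qed

section \<open>Lower bound for orthant probabilities\<close>

lemma Z_scaled_interval_ge:
  assumes "0 < s" "0 < \<delta>" "0 < \<epsilon>"
  shows "\<forall>\<^sub>F t in at_top. exp (- t * (\<theta> * s + \<epsilon>)) \<le> prob (Z -` {t * s..t * (s + \<delta>)} \<inter> space M)"
proof -
  \<comment> \<open>Two errors of at most \<epsilon> / 2 each: \<eta> comes from the rate of the
    density, and \<open>d\<close> from evaluating the density at the right end of a shortened
    interval.\<close>
  define \<eta> where "\<eta> = \<epsilon> / (2 * (s + \<delta>))"
  define d where "d = min \<delta> (\<epsilon> / (2 * \<theta>))"
  have \<eta>: "0 < \<eta>" and d: "0 < d" "d \<le> \<delta>" using assms \<theta>_pos by (auto simp: \<eta>_def d_def)
  have "(\<theta> + \<eta>) * (s + d) = \<theta> * s + \<theta> * d + \<eta> * (s + d)" by (simp add: algebra_simps)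
  moreover have "\<theta> * d \<le> \<theta> * (\<epsilon> / (2 * \<theta>))" using \<theta>_pos by (intro mult_left_mono) (auto simp: d_def)
  then have "\<theta> * d \<le> \<epsilon> / 2" using \<theta>_pos by simp
  moreover have "\<eta> * (s + d) \<le> \<eta> * (s + \<delta>)" using \<eta> d by simp
  then have "\<eta> * (s + d) \<le> \<epsilon> / 2" using assms by (simp add: \<eta>_def divide_simps)
  ultimately have rate: "(\<theta> + \<eta>) * (s + d) \<le> \<theta> * s + \<epsilon>" by linarith
  obtain s0 where s0: "\<And>r. s0 \<le> r \<Longrightarrow> exp (- (\<theta> + \<eta>) * r) \<le> \<rho> r"
    using \<rho>_lower[OF \<eta>] by (auto simp: eventually_at_top_linorder)
  show ?thesis
    \<comment> \<open>The first threshold puts the interval beyond \<open>s0\<close>; the second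
      makes its length at least 1, so that the infimum of the density already bounds the
      mass.\<close>
    using eventually_ge_at_top[of "max (s0 / s) (1 / d)"] eventually_gt_at_top[of 0]
  proof eventually_elim
    case (elim t)
    then have t: "s0 \<le> t * s" "1 \<le> t * d" "0 < t" using assms d by (auto simp: field_simps)
    define m where "m = exp (- (\<theta> + \<eta>) * (t * (s + d)))"
    have low: "m \<le> \<rho> r" if "r \<in> {t * s..t * (s + d)}" for r
    proof -
      have "m \<le> exp (- (\<theta> + \<eta>) * r)"
        using that \<theta>_pos \<eta> by (auto simp: m_def intro!: mult_left_mono)
      also have "\<dots> \<le> \<rho> r" using that t by (intro s0) auto
      finally show ?thesis .
    qed
    have "exp (- t * (\<theta> * s + \<epsilon>)) \<le> exp (- t * ((\<theta> + \<eta>) * (s + d)))"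
      using rate t by simp
    also have "\<dots> = m * 1" by (simp add: m_def algebra_simps)
    also have "\<dots> \<le> m * (t * (s + d) - t * s)"
      using t by (intro mult_left_mono) (auto simp: m_def algebra_simps)
    finally have "ennreal (exp (- t * (\<theta> * s + \<epsilon>))) \<le> ennreal (m * (t * (s + d) - t * s))"
      by (rule ennreal_leI)
    also have "\<dots> \<le> emeasure (distr M borel Z) {t * s..t * (s + d)}"
      unfolding distr_Z using \<rho>_measurable low t d by (intro emeasure_density_Icc_ge) (auto simp: m_def)
    also have "\<dots> = prob (Z -` {t * s..t * (s + d)} \<inter> space M)"
      by (simp add: emeasure_distr emeasure_eq_measure)
    finally have "exp (- t * (\<theta> * s + \<epsilon>)) \<le> prob (Z -` {t * s..t * (s + d)} \<inter> space M)"
      by simp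
    also have "\<dots> \<le> prob (Z -` {t * s..t * (s + \<delta>)} \<inter> space M)"
    proof (intro finite_measure_mono)
      have "t * (s + d) \<le> t * (s + \<delta>)" using t d by simp
      then show "Z -` {t * s..t * (s + d)} \<inter> space M \<subseteq> Z -` {t * s..t * (s + \<delta>)} \<inter> space M" by auto
    qed measurable
    finally show ?case .
  qed
qed

text \<open>With \<open>Z = t * s'\<close> and the normals equal to \<open>sqrt t\<close> times
  \<open>z'\<close>, every coordinate of \<open>X\<close> is \<open>t\<close> times a function of
  \<open>(s', z')\<close> alone. The strict inequalities at \<open>(s, z)\<close> persist in a
  neighbourhood, and by independence the two costs add up.\<close>

lemma orthant_lower:
  assumes "0 < s" "\<And>i. i \<in> S \<Longrightarrow> s * \<mu> $ i + sqrt s * (A *v z) $ i < - y i" "0 < \<epsilon>"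
  shows "\<forall>\<^sub>F t in at_top. exp (- t * (\<theta> * s + (norm z)\<^sup>2 / 2 + \<epsilon>)) \<le> prob (orthant S (\<lambda>i. - t * y i))"
proof -
  define U where "U = (\<Inter>i\<in>S. {p. fst p * \<mu> $ i + sqrt (fst p) * (A *v snd p) $ i < - y i})"
  have "open U"
    unfolding U_def matrix_vector_mult_def
    by (intro open_INT finite ballI open_Collect_less continuous_intros)
  moreover have "(s, z) \<in> U" using assms by (auto simp: U_def)
  ultimately obtain e where e: "0 < e" "ball (s, z) e \<subseteq> U" by (meson open_contains_ball)
  \<comment> \<open>The distance is at most the sum of the time deviation and the coordinate
    deviations of \<open>z'\<close>, each at most \<delta>, hence at most
    \<open>e / 2\<close>.\<close>
  define \<delta> where "\<delta> = e / (2 * (1 + CARD('n)))"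
  have \<delta>: "0 < \<delta>" using e by (simp add: \<delta>_def)
  have inU: "(s', z') \<in> U" if "s \<le> s'" "s' \<le> s + \<delta>" "\<And>i. \<bar>z' $ i - z $ i\<bar> \<le> \<delta>" for s' z'
  proof -
    have "dist (s, z) (s', z') \<le> norm (s' - s) + norm (z' - z)"
      using norm_Pair_le[of "s' - s" "z' - z"] by (subst dist_commute) (simp add: dist_norm)
    also have "norm (z' - z) \<le> (\<Sum>i\<in>UNIV. \<bar>(z' - z) $ i\<bar>)" by (rule norm_le_l1_cart)
    also have "\<dots> \<le> (\<Sum>i\<in>(UNIV::'n set). \<delta>)" using that by (intro sum_mono) simp
    also have "norm (s' - s) \<le> \<delta>" using that by simp
    finally have "dist (s, z) (s', z') \<le> \<delta> * (1 + CARD('n))" by (simp add: algebra_simps)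
    also have "\<dots> < e" using e by (simp add: \<delta>_def divide_simps)
    finally show ?thesis using e by auto
  qed
  have nz: "(norm z)\<^sup>2 = (\<Sum>i\<in>UNIV. (z $ i)\<^sup>2)" by (simp add: norm_vec_def L2_set_def sum_nonneg)
  have "0 < \<epsilon> / 2" using assms by simp
  note Z_scaled_interval_ge[OF assms(1) \<delta> this] std_gauss_scaled_box_ge[OF \<delta> this, of "\<lambda>i. z $ i"]
  then show ?thesis using eventually_gt_at_top[of 0]
  proof eventually_elim
    case (elim t)
    define lo hi :: "real ^ 'n" where "lo = (\<chi> i. sqrt t * (z $ i - \<delta>))" and "hi = (\<chi> i. sqrt t * (z $ i + \<delta>))"
    \<comment> \<open>An image of a compact box is compact and hence Borel. The constraint on the
      normals thus becomes an event of \<open>Y\<close>, to which independence from \<open>Z\<close>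
      applies.\<close>
    define B where "B = (\<lambda>v. A *v v) ` cbox lo hi"
    have "compact B" unfolding B_def matrix_vector_mult_def
      by (intro compact_continuous_image continuous_intros compact_cbox)
    then have [measurable]: "B \<in> sets borel" by (intro borel_closed compact_imp_closed)
    define I where "I = {t * s..t * (s + \<delta>)}"
    have "measure std_gauss (\<Pi>\<^sub>E i\<in>UNIV. {sqrt t * (z $ i - \<delta>)..sqrt t * (z $ i + \<delta>)})
      \<le> measure std_gauss ((\<lambda>g. A *v (\<chi> i. g i)) -` B \<inter> space std_gauss)"
    proof (rule std_gauss.finite_measure_mono)
      show "(\<lambda>g. A *v (\<chi> i. g i)) -` B \<inter> space std_gauss \<in> sets std_gauss"
        by measurable
    qed (auto simp: space_PiM B_def mem_box_cart lo_def hi_def PiE_iff intro!: imageI)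
    also have "\<dots> = measure (distr M borel Y) B"
      unfolding Y_distr by (simp add: measure_distr)
    also have "\<dots> = prob (Y -` B \<inter> space M)" by (simp add: measure_distr)
    finally have PY: "exp (- t * ((norm z)\<^sup>2 / 2 + \<epsilon> / 2)) \<le> prob (Y -` B \<inter> space M)"
      using elim(2) by (simp add: nz)
    have "exp (- t * (\<theta> * s + (norm z)\<^sup>2 / 2 + \<epsilon>))
        = exp (- t * (\<theta> * s + \<epsilon> / 2)) * exp (- t * ((norm z)\<^sup>2 / 2 + \<epsilon> / 2))"
      by (simp add: exp_add[symmetric] algebra_simps)
    also have "\<dots> \<le> prob (Z -` I \<inter> space M) * prob (Y -` B \<inter> space M)"
      using elim(1) PY by (intro mult_mono) (auto simp: I_def)
    also have "\<dots> = prob ((\<lambda>\<omega>. (Z \<omega>, Y \<omega>)) -` (I \<times> B) \<inter> space M)"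
      by (rule prob_ZY[symmetric]) (auto simp: I_def)
    also have "\<dots> \<le> prob (orthant S (\<lambda>i. - t * y i))"
    proof (intro finite_measure_mono subsetI)
      fix \<omega> assume "\<omega> \<in> (\<lambda>\<omega>. (Z \<omega>, Y \<omega>)) -` (I \<times> B) \<inter> space M"
      then obtain v where v: "v \<in> cbox lo hi" "Y \<omega> = A *v v" and Z: "Z \<omega> \<in> I" and "\<omega> \<in> space M"
        by (auto simp: B_def)
      define s' z' where "s' = Z \<omega> / t" and "z' = (1 / sqrt t) *\<^sub>R v"
      have "s \<le> s'" "s' \<le> s + \<delta>" using Z elim(3) by (auto simp: I_def s'_def field_simps)
      moreover have "\<bar>z' $ i - z $ i\<bar> \<le> \<delta>" for i
      proof -
        have "lo $ i \<le> v $ i" "v $ i \<le> hi $ i" using v(1) by (auto simp: mem_box_cart)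
        then have "z $ i - \<delta> \<le> v $ i / sqrt t" "v $ i / sqrt t \<le> z $ i + \<delta>"
          using elim(3) by (auto simp: lo_def hi_def field_simps)
        then show ?thesis by (simp add: z'_def)
      qed
      ultimately have U: "(s', z') \<in> U" by (rule inU)
      have Zs: "Z \<omega> = t * s'" and vz: "v = sqrt t *\<^sub>R z'" using elim(3) by (auto simp: s'_def z'_def)
      have "X \<omega> $ i \<le> - t * y i" if "i \<in> S" for i
      proof -
        have "X \<omega> $ i = t * (s' * \<mu> $ i + sqrt s' * (A *v z') $ i)"
          using elim(3) by (simp add: X_def v(2) Zs vz matrix_vector_mult_scaleR real_sqrt_mult algebra_simps)
        also have "\<dots> \<le> t * (- y i)"
          using U that elim(3) by (intro mult_left_mono) (auto simp: U_def intro: less_imp_le)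
        finally show ?thesis by simp
      qed
      then show "\<omega> \<in> orthant S (\<lambda>i. - t * y i)" using \<open>\<omega> \<in> space M\<close> by (simp add: orthant_def)
    qed simp
    finally show ?case .
  qed
qed

lemma orthant_mono: "(\<And>i. i \<in> S \<Longrightarrow> x i \<le> y i) \<Longrightarrow> prob (orthant S x) \<le> prob (orthant S y)"
  by (intro finite_measure_mono orthant_sets) (force simp: orthant_def)

text \<open>Convexity along the ray from 0, where \<open>exponent\<close> vanishes: the value at
  \<open>c *\<^sub>R w\<close> is at most c \<theta>. This supplies the strict inequality required
  by \<open>orthant_chernoff\<close>.\<close>

lemma exponent_scale_less:
  assumes "exponent w = \<theta>" "0 < c" "c < 1"
  shows "exponent (c *\<^sub>R w) < \<theta>"
proof -
  let ?q = "(norm (transpose A *v w))\<^sup>2 / 2"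
  have "exponent (c *\<^sub>R w) = c\<^sup>2 * ?q - c * (w \<bullet> \<mu>)"
    using assms by (simp add: exponent_def transpose_mult_scaleR power_mult_distrib del: transpose_matrix_vector)
  also have "c\<^sup>2 * ?q \<le> c * ?q"
    using assms by (intro mult_right_mono) (auto simp: power2_eq_square mult_left_le)
  also have "c * ?q - c * (w \<bullet> \<mu>) = c * \<theta>" using assms(1) by (simp add: exponent_def algebra_simps)
  also have "\<dots> < \<theta>" using assms \<theta>_pos by simp
  finally show ?thesis by simp
qed

text \<open>The point \<open>(s, - sqrt s *\<^sub>R (transpose A *v w))\<close> is the cheapest value of \<open>Z\<close> and of the
  standard normals behind \<open>Y\<close> (both rescaled) that puts \<open>X\<close> into the orthant, and \<open>w\<close> is the
  Lagrange multiplier; the hypotheses on \<open>s\<close> are the Karush--Kuhn--Tucker conditions.\<close>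

lemma orthant_limit:
  fixes F :: "'u filter"
  assumes w: "exponent w = \<theta>" "\<And>i. 0 \<le> w $ i" "\<And>i. i \<notin> S \<Longrightarrow> w $ i = 0"
    and y: "\<And>i. i \<in> S \<Longrightarrow> 0 < y i"
    and s: "0 < s" "\<And>i. i \<in> S \<Longrightarrow> y i \<le> s * ((A *v (transpose A *v w)) $ i - \<mu> $ i)"
      "s * (\<theta> + (norm (transpose A *v w))\<^sup>2 / 2) = (\<Sum>i\<in>S. w $ i * y i)"
    and t: "filterlim t at_top F"
    and x: "\<And>i. i \<in> S \<Longrightarrow> ((\<lambda>u. x u i / t u) \<longlongrightarrow> - y i) F"
  shows "((\<lambda>u. ln (prob (orthant S (x u))) / t u) \<longlongrightarrow> - (\<Sum>i\<in>S. w $ i * y i)) F"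
proof -
  define V where "V = (\<Sum>i\<in>S. w $ i * y i)"
  have tpos: "\<forall>\<^sub>F u in F. 0 < t u" using t by (auto simp: filterlim_at_top_dense)
  have lower: "\<forall>\<^sub>F u in F. exp (- t u * ((1 + 2 * \<eta>) * V + \<eta>)) \<le> prob (orthant S (x u))" if "0 < \<eta>" for \<eta>
  proof -
    \<comment> \<open>Two margins above 1: the target is enlarged by \<open>1 + \<eta>\<close> to
      absorb the error in the convergence of \<open>x u i / t u\<close>, and the point by
      \<open>1 + 2 * \<eta>\<close> to reach the enlarged target strictly.\<close>
    define c where "c = 1 + 2 * \<eta>"
    define z where "z = - sqrt (c * s) *\<^sub>R (transpose A *v w)"
    have c: "1 + \<eta> < c" "0 < c" using that by (auto simp: c_def)
    have "\<forall>\<^sub>F r in at_top. exp (- r * (\<theta> * (c * s) + (norm z)\<^sup>2 / 2 + \<eta>))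
        \<le> prob (orthant S (\<lambda>i. - r * ((1 + \<eta>) * y i)))"
    proof (rule orthant_lower)
      fix i assume i: "i \<in> S"
      have "(1 + \<eta>) * y i < c * y i" using y[OF i] c by simp
      also have "\<dots> \<le> c * (s * ((A *v (transpose A *v w)) $ i - \<mu> $ i))"
        using s(2)[OF i] c by simp
      finally have "(1 + \<eta>) * y i < c * s * ((A *v (transpose A *v w)) $ i - \<mu> $ i)"
        by (simp add: mult.assoc)
      moreover have "sqrt (c * s) * (A *v z) $ i = - (c * s) * (A *v (transpose A *v w)) $ i"
        using c s(1) unfolding z_def matrix_vector_mult_scaleR by simp
      ultimately show "c * s * \<mu> $ i + sqrt (c * s) * (A *v z) $ i < - ((1 + \<eta>) * y i)"
        by (simp add: algebra_simps)
    qed (use c s(1) that in auto)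
    moreover have "\<theta> * (c * s) + (norm z)\<^sup>2 / 2 = c * V"
    proof -
      have "(norm z)\<^sup>2 = c * s * (norm (transpose A *v w))\<^sup>2"
        using c s(1) by (simp add: z_def power_mult_distrib del: transpose_matrix_vector)
      then have "\<theta> * (c * s) + (norm z)\<^sup>2 / 2 = c * (s * (\<theta> + (norm (transpose A *v w))\<^sup>2 / 2))"
        by (simp add: algebra_simps del: transpose_matrix_vector)
      then show ?thesis using s(3) by (simp only: V_def)
    qed
    ultimately have "\<forall>\<^sub>F u in F. exp (- t u * (c * V + \<eta>)) \<le> prob (orthant S (\<lambda>i. - t u * ((1 + \<eta>) * y i)))"
      by (intro eventually_compose_filterlim[OF _ t]) simp
    moreover have "\<forall>\<^sub>F u in F. \<forall>i\<in>S. - ((1 + \<eta>) * y i) < x u i / t u"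
      using that y by (intro eventually_ball_finite ballI order_tendstoD(1)[OF x]) (auto simp: algebra_simps)
    ultimately show ?thesis using tpos
    proof eventually_elim
      case (elim u)
      have "- t u * ((1 + \<eta>) * y i) \<le> x u i" if "i \<in> S" for i
        using elim(2)[rule_format, OF that] elim(3) by (simp add: pos_less_divide_eq mult.commute)
      then show ?case using orthant_mono[of S "\<lambda>i. - t u * ((1 + \<eta>) * y i)" "x u"] elim(1)
        by (simp add: c_def)
    qed
  qed
  show ?thesis unfolding V_def[symmetric]
  proof (rule order_tendstoI)
    fix a assume a: "a < - V"
    have "((\<lambda>\<eta>. (1 + 2 * \<eta>) * V + \<eta>) \<longlongrightarrow> (1 + 2 * 0) * V + 0) (at_right 0)"
      by (intro tendsto_intros)
    from order_tendstoD(2)[OF this, of "- a"] a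
    have "\<forall>\<^sub>F \<eta> in at_right 0. (1 + 2 * \<eta>) * V + \<eta> < - a" by simp
    moreover have "\<forall>\<^sub>F \<eta> in at_right (0::real). 0 < \<eta>" by (rule eventually_at_right_less)
    ultimately have "\<forall>\<^sub>F \<eta> in at_right 0. (1 + 2 * \<eta>) * V + \<eta> < - a \<and> 0 < \<eta>"
      by eventually_elim simp
    then obtain \<eta> where \<eta>: "(1 + 2 * \<eta>) * V + \<eta> < - a" "0 < \<eta>"
      using eventually_happens[of _ "at_right (0::real)"] by auto
    from lower[OF \<eta>(2)] tpos show "\<forall>\<^sub>F u in F. a < ln (prob (orthant S (x u))) / t u"
    proof eventually_elim
      case (elim u)
      then have "ln (exp (- t u * ((1 + 2 * \<eta>) * V + \<eta>))) \<le> ln (prob (orthant S (x u)))"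
        by (subst ln_le_cancel_iff) (auto intro: less_le_trans[OF exp_gt_zero])
      moreover have "t u * a < - t u * ((1 + 2 * \<eta>) * V + \<eta>)"
        using mult_strict_left_mono[OF \<eta>(1), of "t u"] elim by simp
      ultimately show ?case using elim by (simp add: pos_less_divide_eq mult.commute)
    qed
  next
    fix a assume a: "- V < a"
    have "((\<lambda>\<eta>. - (1 - \<eta>)\<^sup>2 * V) \<longlongrightarrow> - (1 - 0)\<^sup>2 * V) (at_right 0)"
      by (intro tendsto_intros)
    from order_tendstoD(2)[OF this, of a] a
    have "\<forall>\<^sub>F \<eta> in at_right 0. - (1 - \<eta>)\<^sup>2 * V < a" by simp
    moreover have "\<forall>\<^sub>F \<eta> in at_right (0::real). \<eta> \<in> {0<..<1}" by (rule eventually_at_right_real) simp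
    ultimately have "\<forall>\<^sub>F \<eta> in at_right 0. - (1 - \<eta>)\<^sup>2 * V < a \<and> 0 < \<eta> \<and> \<eta> < 1"
      by eventually_elim simp
    then obtain \<eta> where \<eta>: "- (1 - \<eta>)\<^sup>2 * V < a" "0 < \<eta>" "\<eta> < 1"
      using eventually_happens[of _ "at_right (0::real)"] by auto
    \<comment> \<open>One factor \<open>c\<close> moves the multiplier into the interior of the
      domain, the other weakens the target \<open>y i\<close> to \<open>c * y i\<close>; together
      they produce \<open>c\<^sup>2\<close>.\<close>
    define c where "c = 1 - \<eta>"
    have c: "0 < c" "c < 1" "- (c\<^sup>2) * V < a" using \<eta> by (auto simp: c_def)
    obtain K where K: "0 < K" "\<And>x. prob (orthant S x) \<le> K * exp (\<Sum>i\<in>S. (c *\<^sub>R w) $ i * x i)"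
      using orthant_chernoff[of "c *\<^sub>R w" S] exponent_scale_less[OF w(1) c(1,2)] w(2,3) c by auto
    have "((\<lambda>u. ln K / t u) \<longlongrightarrow> 0) F"
      by (rule real_tendsto_divide_at_top[OF tendsto_const t])
    then have "((\<lambda>u. ln K / t u + - (c\<^sup>2) * V) \<longlongrightarrow> 0 + - (c\<^sup>2) * V) F"
      by (intro tendsto_intros)
    from order_tendstoD(2)[OF this, of a] c
    have "\<forall>\<^sub>F u in F. ln K / t u + - (c\<^sup>2) * V < a" by simp
    moreover have "\<forall>\<^sub>F u in F. \<forall>i\<in>S. x u i / t u < - (c * y i)"
      using y c by (intro eventually_ball_finite ballI order_tendstoD(2)[OF x]) auto
    \<comment> \<open>The lower bound also shows that the probability is positive, so that
      monotonicity of \<open>ln\<close> may be used.\<close>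
    moreover note lower[of 1, simplified] tpos
    ultimately show "\<forall>\<^sub>F u in F. ln (prob (orthant S (x u))) / t u < a"
    proof eventually_elim
      case (elim u)
      have pos: "0 < prob (orthant S (x u))" by (rule less_le_trans[OF exp_gt_zero elim(3)])
      have "(\<Sum>i\<in>S. (c *\<^sub>R w) $ i * x u i) \<le> (\<Sum>i\<in>S. (c *\<^sub>R w) $ i * (- (t u) * (c * y i)))"
      proof (intro sum_mono mult_left_mono)
        fix i assume "i \<in> S"
        then have "x u i / t u < - (c * y i)" using elim(2) by simp
        then show "x u i \<le> - (t u) * (c * y i)" using elim(4) by (simp add: pos_divide_less_eq mult.commute)
      qed (use w c in auto)
      also have "\<dots> = - (c\<^sup>2) * V * t u"
        by (simp add: V_def sum_distrib_left sum_negf power2_eq_square ac_simps)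
      finally have "prob (orthant S (x u)) \<le> K * exp (- (c\<^sup>2) * V * t u)"
        using K(2)[of "x u"] K(1) by (meson exp_le_cancel_iff mult_left_mono order_trans less_imp_le)
      then have "ln (prob (orthant S (x u))) \<le> ln (K * exp (- (c\<^sup>2) * V * t u))"
        using pos K(1) by (subst ln_le_cancel_iff) auto
      also have "\<dots> = ln K - (c\<^sup>2) * V * t u" using K(1) by (simp add: ln_mult)
      finally have "ln (prob (orthant S (x u))) / t u \<le> (ln K - (c\<^sup>2) * V * t u) / t u"
        using elim(4) by (intro divide_right_mono) auto
      also have "\<dots> = ln K / t u + - (c\<^sup>2) * V" using elim(4) by (simp add: diff_divide_distrib)
      also have "\<dots> < a" by fact
      finally show ?case .
    qed
  qed
qed

section \<open>Continuity and positivity of marginal distribution functions\<close>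

definition marginal :: "'n \<Rightarrow> real measure" where
  "marginal i = distr M borel (\<lambda>\<omega>. X \<omega> $ i)"

lemma real_distribution_marginal: "real_distribution (marginal i)"
  unfolding marginal_def by (rule real_distribution_distr) simp

lemma cdf_marginal: "cdf (marginal i) x = prob (orthant {i} (\<lambda>_. x))"
proof -
  have "(\<lambda>\<omega>. X \<omega> $ i) -` {..x} \<inter> space M = orthant {i} (\<lambda>_. x)" by (auto simp: orthant_def)
  then show ?thesis by (simp add: cdf_def marginal_def measure_distr)
qed

lemma Y_no_atoms:
  assumes "A $ i \<noteq> 0"
  shows "AE y in distr M borel Y. y $ i \<noteq> c"
proof -
  obtain k where "A $ i $ k \<noteq> 0" using assms by (auto simp: vec_eq_iff)
  then have "AE g in std_gauss. (\<Sum>j\<in>UNIV. A $ i $ j * g j) \<noteq> c"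
    by (rule std_gauss_hyperplane_null)
  then show ?thesis
    unfolding Y_distr by (subst AE_distr_iff) (auto simp: matrix_vector_mult_def)
qed

text \<open>For fixed \<open>s > 0\<close> the event that the component equals \<open>x\<close>
  prescribes one value of \<open>y $ i\<close>, which has probability 0; Fubini then removes atoms
  from the mixture.\<close>

lemma isCont_cdf_marginal:
  assumes "A $ i \<noteq> 0"
  shows "isCont (cdf (marginal i)) x"
proof -
  interpret DY: prob_space "distr M borel Y" by (rule prob_space_distr) simp
  interpret DZ: prob_space "distr M borel Z" by (rule prob_space_distr) simp
  interpret DZY: pair_sigma_finite "distr M borel Z" "distr M borel Y" ..
  interpret D: real_distribution "marginal i" by (rule real_distribution_marginal)
  have "AE s in distr M borel Z. 0 < s" using Z_pos by (subst AE_distr_iff) auto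
  then have "AE s in distr M borel Z. AE y in distr M borel Y. sqrt s * y $ i + s * \<mu> $ i \<noteq> x"
  proof eventually_elim
    case (elim s)
    from Y_no_atoms[OF assms, of "(x - s * \<mu> $ i) / sqrt s"] show ?case
      by eventually_elim (use elim in \<open>auto simp: field_simps\<close>)
  qed
  then have "AE p in distr M borel Z \<Otimes>\<^sub>M distr M borel Y. sqrt (fst p) * snd p $ i + fst p * \<mu> $ i \<noteq> x"
  proof (intro DZY.AE_pair_measure)
    have "{p \<in> space (borel \<Otimes>\<^sub>M borel). sqrt (fst p) * snd p $ i + fst p * \<mu> $ i \<noteq> x} \<in> sets (borel \<Otimes>\<^sub>M borel)"
      by measurable
    then show "{p \<in> space (distr M borel Z \<Otimes>\<^sub>M distr M borel Y). sqrt (fst p) * snd p $ i + fst p * \<mu> $ i \<noteq> x}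
        \<in> sets (distr M borel Z \<Otimes>\<^sub>M distr M borel Y)"
      unfolding distr_ZY by simp
  qed simp
  then have "AE \<omega> in M. X \<omega> $ i \<noteq> x"
    unfolding distr_ZY by (subst (asm) AE_distr_iff) (auto simp: X_def)
  then have "prob {\<omega> \<in> space M. X \<omega> $ i = x} = 0"
    by (subst prob_eq_0) auto
  moreover have "(\<lambda>\<omega>. X \<omega> $ i) -` {x} \<inter> space M = {\<omega> \<in> space M. X \<omega> $ i = x}" by auto
  ultimately have "measure (marginal i) {x} = 0"
    by (simp add: marginal_def measure_distr)
  then show ?thesis by (simp add: D.isCont_cdf)
qed

text \<open>The margin has no finite lower endpoint, which later forces the quantiles of
  \<open>u powr (l $ i)\<close> to tend to minus infinity as \<open>u\<close> tends to 0.\<close>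

lemma cdf_marginal_pos:
  assumes "A $ i \<noteq> 0"
  shows "0 < cdf (marginal i) x"
proof -
  \<comment> \<open>The multiple of the row whose inner product with the row is
    \<open>- (\<bar>\<mu> $ i\<bar> + 2)\<close>; adding the drift at time 1 leaves at most
    -2.\<close>
  define z where "z = (- (\<bar>\<mu> $ i\<bar> + 2) / (norm (A $ i))\<^sup>2) *\<^sub>R (A $ i)"
  have "(A *v z) $ i = A $ i \<bullet> z" by (simp add: matrix_vector_mult_def inner_vec_def)
  also have "\<dots> = - (\<bar>\<mu> $ i\<bar> + 2)" using assms by (simp add: z_def power2_norm_eq_inner)
  finally have Az: "1 * \<mu> $ i + sqrt 1 * (A *v z) $ i < - 1" by simp
  have "\<forall>\<^sub>F t in at_top. exp (- t * (\<theta> * 1 + (norm z)\<^sup>2 / 2 + 1)) \<le> prob (orthant {i} (\<lambda>i. - t * 1))"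
    by (rule orthant_lower) (use Az in auto)
  then have "\<forall>\<^sub>F t in at_top. exp (- t * (\<theta> * 1 + (norm z)\<^sup>2 / 2 + 1)) \<le> prob (orthant {i} (\<lambda>i. - t * 1)) \<and> - x \<le> t"
    using eventually_ge_at_top by (rule eventually_conj)
  then obtain t where t: "exp (- t * (\<theta> * 1 + (norm z)\<^sup>2 / 2 + 1)) \<le> prob (orthant {i} (\<lambda>i. - t * 1))" "- x \<le> t"
    using eventually_happens[of _ "at_top :: real filter"] by auto
  then have "prob (orthant {i} (\<lambda>i. - t * 1)) \<le> prob (orthant {i} (\<lambda>_. x))"
    by (intro orthant_mono) auto
  then show ?thesis unfolding cdf_marginal
    using t(1) by (meson exp_gt_zero less_le_trans)
qed

end

subsection \<open>The variational problem\<close>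

definition tail_rate :: "real \<Rightarrow> real ^ 'n ^ 'n \<Rightarrow> real ^ 'n \<Rightarrow> real ^ 'n \<Rightarrow> real" where
  "tail_rate \<theta> R m v = sqrt (2 * \<theta> * (v \<bullet> (R *v v)) + (m \<bullet> v)\<^sup>2) - m \<bullet> v"

lemma margin_weight_pos:
  fixes \<theta> a :: real
  assumes "0 < \<theta>"
  shows "0 < sqrt (2 * \<theta> + a\<^sup>2) - a"
proof -
  have "a \<le> sqrt (a\<^sup>2)" by simp
  also have "\<dots> < sqrt (2 * \<theta> + a\<^sup>2)" using assms by (simp only: real_sqrt_less_iff)
  finally show ?thesis by simp
qed

text \<open>For \<open>l\<close> in \<open>tail_directions\<close> these points are the vertices of
  the simplex \<open>tail_weights\<close>. They show that it is nonempty and serve as directions for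
  the first-order condition.\<close>

lemma axis_in_tail_weights:
  fixes m l :: "real ^ 'n"
  assumes "0 < \<theta>" "0 < l $ i"
  shows "axis i (1 / (l $ i * (sqrt (2 * \<theta> + (m $ i)\<^sup>2) - m $ i))) \<in> tail_weights \<theta> m l"
    (is "axis i ?c \<in> _")
proof -
  note pos = margin_weight_pos[OF assms(1), of "m $ i"]
  have "(\<Sum>j\<in>UNIV. axis i ?c $ j * l $ j * (sqrt (2 * \<theta> + (m $ j)\<^sup>2) - m $ j))
      = (\<Sum>j\<in>UNIV. if j = i then ?c * l $ i * (sqrt (2 * \<theta> + (m $ i)\<^sup>2) - m $ i) else 0)"
    by (rule sum.cong) (auto simp: axis_def)
  also have "\<dots> = 1" using pos assms(2) by simp
  finally show ?thesis using pos assms by (auto simp: tail_weights_def axis_def)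
qed

lemma compact_tail_weights:
  fixes m l :: "real ^ 'n"
  assumes "0 < \<theta>" "l \<in> tail_directions"
  shows "compact (tail_weights \<theta> m l)"
proof (rule compact_eq_bounded_closed[THEN iffD2], rule conjI)
  define k where "k i = l $ i * (sqrt (2 * \<theta> + (m $ i)\<^sup>2) - m $ i)" for i
  have k: "0 \<le> k i" "l $ i \<noteq> 0 \<Longrightarrow> 0 < k i" for i
    using margin_weight_pos[OF assms(1), of "m $ i"] assms(2)
    by (auto simp: k_def tail_directions_def order.strict_iff_order)
  have "\<bar>v $ i\<bar> \<le> 1 / k i" if "v \<in> tail_weights \<theta> m l" for v i
  proof (cases "l $ i = 0")
    case True
    \<comment> \<open>Both sides are 0: \<open>v $ i\<close> vanishes by the last condition on
      \<open>tail_weights\<close>, and \<open>1 / k i\<close> is a division by zero.\<close>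
    then show ?thesis using that by (simp add: tail_weights_def k_def)
  next
    case False
    have "v $ i * k i \<le> (\<Sum>j\<in>UNIV. v $ j * k j)"
      using that k by (intro member_le_sum) (auto simp: tail_weights_def)
    also have "\<dots> = 1" using that by (simp add: tail_weights_def k_def mult.assoc)
    finally show ?thesis using that k(2)[OF False] by (simp add: tail_weights_def pos_le_divide_eq)
  qed
  then show "bounded (tail_weights \<theta> m l)"
    unfolding bounded_def
    by (intro exI[of _ 0] exI[of _ "\<Sum>i\<in>UNIV. 1 / k i"] ballI)
      (auto intro!: order_trans[OF norm_le_l1_cart] sum_mono)
  show "closed (tail_weights \<theta> m l)"
    unfolding tail_weights_def
    by (intro closed_Collect_conj closed_Collect_all closed_Collect_le closed_Collect_eq
        closed_Collect_imp open_Collect_const continuous_intros)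
qed

lemma tail_rate_minimiser_exists:
  fixes R :: "real ^ 'n ^ 'n"
  assumes "0 < \<theta>" "l \<in> tail_directions"
  obtains v where "v \<in> tail_weights \<theta> m l"
    "\<And>w. w \<in> tail_weights \<theta> m l \<Longrightarrow> tail_rate \<theta> R m v \<le> tail_rate \<theta> R m w"
proof -
  obtain k where "0 < l $ k" using assms(2) by (auto simp: tail_directions_def)
  then have "tail_weights \<theta> m l \<noteq> {}" using axis_in_tail_weights[OF assms(1)] by blast
  moreover have "continuous_on (tail_weights \<theta> m l) (tail_rate \<theta> R m)"
    unfolding tail_rate_def matrix_vector_mult_def by (intro continuous_intros)
  ultimately show thesis
    using continuous_attains_inf[OF compact_tail_weights[OF assms]] that by blast
qed

lemma convex_combination_tail_weights:
  assumes "v \<in> tail_weights \<theta> m l" "w \<in> tail_weights \<theta> m l" "0 \<le> t" "t \<le> 1"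
  shows "v + t *\<^sub>R (w - v) \<in> tail_weights \<theta> m l"
proof -
  let ?k = "\<lambda>i. l $ i * (sqrt (2 * \<theta> + (m $ i)\<^sup>2) - m $ i)"
  have eq: "(v + t *\<^sub>R (w - v)) $ i = (1 - t) * v $ i + t * w $ i" for i
    by (simp add: algebra_simps)
  have "(\<Sum>i\<in>UNIV. (v + t *\<^sub>R (w - v)) $ i * ?k i) = (1 - t) * (\<Sum>i\<in>UNIV. v $ i * ?k i) + t * (\<Sum>i\<in>UNIV. w $ i * ?k i)"
    unfolding eq by (simp only: sum_distrib_left sum.distrib[symmetric] distrib_right mult.assoc)
  also have "\<dots> = 1" using assms by (simp add: tail_weights_def mult.assoc)
  finally have "(\<Sum>i\<in>UNIV. (v + t *\<^sub>R (w - v)) $ i * ?k i) = 1" .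
  moreover have "0 \<le> (v + t *\<^sub>R (w - v)) $ i" for i
    unfolding eq using assms by (simp add: tail_weights_def)
  moreover have "l $ i = 0 \<longrightarrow> (v + t *\<^sub>R (w - v)) $ i = 0" for i
    unfolding eq using assms by (simp add: tail_weights_def)
  ultimately show ?thesis unfolding tail_weights_def by (simp only: mem_Collect_eq mult.assoc) blast
qed

text \<open>Along the segment from the minimiser to the vertex on axis \<open>i\<close> the rate has
  a nonnegative one-sided derivative. Homogeneity of the rate turns this into a Karush--Kuhn--Tucker
  inequality whose multiplier is the minimal rate itself.\<close>

lemma tail_rate_minimiser_gradient:
  fixes R :: "real ^ 'n ^ 'n" and m l :: "real ^ 'n"
  assumes "0 < \<theta>" and sym: "\<And>x y. x \<bullet> (R *v y) = y \<bullet> (R *v x)"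
    and pos: "0 < v \<bullet> (R *v v)"
    and v: "v \<in> tail_weights \<theta> m l"
      "\<And>w. w \<in> tail_weights \<theta> m l \<Longrightarrow> tail_rate \<theta> R m v \<le> tail_rate \<theta> R m w"
    and i: "0 < l $ i"
  shows "tail_rate \<theta> R m v * (l $ i * (sqrt (2 * \<theta> + (m $ i)\<^sup>2) - m $ i))
      * sqrt (2 * \<theta> * (v \<bullet> (R *v v)) + (m \<bullet> v)\<^sup>2)
    \<le> 2 * \<theta> * (R *v v) $ i - tail_rate \<theta> R m v * m $ i"
proof -
  define D where "D = sqrt (2 * \<theta> * (v \<bullet> (R *v v)) + (m \<bullet> v)\<^sup>2)"
  define k where "k = l $ i * (sqrt (2 * \<theta> + (m $ i)\<^sup>2) - m $ i)"
  define w where "w = axis i (1 / k)"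
  have w: "w \<in> tail_weights \<theta> m l"
    unfolding w_def k_def by (rule axis_in_tail_weights) fact+
  have k: "0 < k" using i margin_weight_pos[OF assms(1), of "m $ i"] by (simp add: k_def)
  have rad: "0 < 2 * \<theta> * (v \<bullet> (R *v v)) + (m \<bullet> v)\<^sup>2"
    using assms(1) pos by (intro add_pos_nonneg) auto
  then have D: "0 < D" "D\<^sup>2 = 2 * \<theta> * (v \<bullet> (R *v v)) + (m \<bullet> v)\<^sup>2" by (simp_all add: D_def)
  define d where "d = w - v"
  define f where "f t = tail_rate \<theta> R m (v + t *\<^sub>R d)" for t
  define f' where "f' = (2 * \<theta> * (d \<bullet> (R *v v)) + (m \<bullet> v) * (m \<bullet> d)) / D - m \<bullet> d"
  have quad: "(v + t *\<^sub>R d) \<bullet> (R *v (v + t *\<^sub>R d)) = v \<bullet> (R *v v) + t * (2 * (d \<bullet> (R *v v))) + t\<^sup>2 * (d \<bullet> (R *v d))" for t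
    using sym[of v d] by (simp add: matrix_vector_right_distrib matrix_vector_mult_scaleR inner_add_left
        inner_add_right power2_eq_square algebra_simps)
  have "((\<lambda>t. sqrt (2 * \<theta> * (v \<bullet> (R *v v) + t * (2 * (d \<bullet> (R *v v))) + t\<^sup>2 * (d \<bullet> (R *v d))) + (m \<bullet> v + t * (m \<bullet> d))\<^sup>2)
      - (m \<bullet> v + t * (m \<bullet> d))) has_real_derivative f') (at 0)"
    using rad by (auto intro!: derivative_eq_intros simp: f'_def D_def field_simps)
  then have deriv: "(f has_real_derivative f') (at 0)"
    unfolding f_def tail_rate_def quad inner_add_right inner_scaleR_right .
  have "0 \<le> f'"
  proof (rule ccontr)
    assume "\<not> 0 \<le> f'"
    then obtain e where e: "0 < e" "\<And>h. 0 < h \<Longrightarrow> h < e \<Longrightarrow> f (0 + h) < f 0"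
      using DERIV_neg_dec_right[OF deriv] by auto
    define h where "h = min (e / 2) 1"
    have h: "0 < h" "h < e" "h \<le> 1" using e by (auto simp: h_def)
    have "v + h *\<^sub>R d \<in> tail_weights \<theta> m l"
      unfolding d_def using h by (intro convex_combination_tail_weights v w) auto
    from v(2)[OF this] e(2)[OF h(1,2)] show False by (simp add: f_def)
  qed
  then have "0 \<le> D * f'" using D by simp
  also have "D * f' = 2 * \<theta> * (d \<bullet> (R *v v)) + (m \<bullet> v) * (m \<bullet> d) - D * (m \<bullet> d)"
    using D by (simp add: f'_def field_simps)
  also have "\<dots> = 2 * \<theta> * (d \<bullet> (R *v v)) - tail_rate \<theta> R m v * (m \<bullet> d)"
    by (simp add: tail_rate_def D_def algebra_simps)
  also have "\<dots> = (2 * \<theta> * (w \<bullet> (R *v v)) - tail_rate \<theta> R m v * (m \<bullet> w))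
      - (2 * \<theta> * (v \<bullet> (R *v v)) - tail_rate \<theta> R m v * (m \<bullet> v))"
    by (simp add: d_def inner_diff_left inner_diff_right algebra_simps)
  \<comment> \<open>Euler's identity: the rate is homogeneous of degree 1, so its gradient at
    \<open>v\<close> paired with \<open>v\<close> returns the rate. The factor \<open>D\<close>
    clears the denominator of the gradient.\<close>
  also have "2 * \<theta> * (v \<bullet> (R *v v)) - tail_rate \<theta> R m v * (m \<bullet> v) = tail_rate \<theta> R m v * D"
  proof -
    have "tail_rate \<theta> R m v = D - m \<bullet> v" by (simp add: tail_rate_def D_def)
    then show ?thesis using D(2) by (simp only:) (simp add: power2_eq_square algebra_simps)
  qed
  also have "w \<bullet> (R *v v) = (R *v v) $ i / k" by (simp add: w_def inner_axis')
  also have "m \<bullet> w = m $ i / k" by (simp add: w_def inner_axis)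
  finally have "tail_rate \<theta> R m v * D \<le> (2 * \<theta> * (R *v v) $ i - tail_rate \<theta> R m v * m $ i) / k"
    by (simp add: diff_divide_distrib)
  then have "tail_rate \<theta> R m v * k * D \<le> 2 * \<theta> * (R *v v) $ i - tail_rate \<theta> R m v * m $ i"
    using k by (simp only: pos_le_divide_eq ac_simps)
  then show ?thesis unfolding k_def D_def .
qed

subsection \<open>Copulas\<close>

text \<open>The distribution function may have flat pieces, so the sublevel set can exceed
  \<open>{..x}\<close>. By continuity it is closed, and below level 1 it is a half-line whose
  endpoint has the same value.\<close>

lemma (in real_distribution) measure_cdf_le_cdf:
  assumes cont: "\<And>x. isCont (cdf M) x"
  shows "measure M {y. cdf M y \<le> cdf M x} = cdf M x"
proof (cases "cdf M x = 1")
  case True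
  then have "{y. cdf M y \<le> cdf M x} = UNIV" using cdf_bounded_prob by auto
  then show ?thesis using True prob_space by simp
next
  case False
  define S where "S = {y. cdf M y \<le> cdf M x}"
  have "cdf M x < 1" using False cdf_bounded_prob[of x] by simp
  from order_tendstoD(1)[OF cdf_lim_at_top_prob this]
  obtain b where b: "cdf M x < cdf M b"
    using eventually_happens[of _ "at_top :: real filter"] by auto
  have "y \<le> b" if "y \<in> S" for y
    using that b cdf_nondecreasing[of b y] by (auto simp: S_def intro: le_cases[of y b])
  then have bdd: "bdd_above S" by (rule bdd_aboveI)
  have "closed S" unfolding S_def
    using cont by (intro closed_Collect_le continuous_on_const continuous_at_imp_continuous_on) auto
  moreover have "x \<in> S" by (simp add: S_def)
  ultimately have "Sup S \<in> S" using bdd by (intro closed_contains_Sup) auto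
  have "S = {..Sup S}"
  proof (intro equalityI subsetI)
    fix y assume "y \<in> S" then show "y \<in> {..Sup S}" using bdd by (simp add: cSup_upper)
  next
    fix y assume "y \<in> {..Sup S}"
    then have "cdf M y \<le> cdf M (Sup S)" by (intro cdf_nondecreasing) simp
    then show "y \<in> S" using \<open>Sup S \<in> S\<close> by (simp add: S_def)
  qed
  then have "measure M S = cdf M (Sup S)" by (simp add: cdf_def)
  moreover have "cdf M x \<le> cdf M (Sup S)"
    using \<open>x \<in> S\<close> bdd by (intro cdf_nondecreasing cSup_upper)
  ultimately show ?thesis using \<open>Sup S \<in> S\<close> by (simp add: S_def)
qed

lemma (in real_distribution) cdf_measurable [measurable]: "cdf M \<in> borel_measurable borel"
  by (intro borel_measurable_mono monoI cdf_nondecreasing)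

lemma (in real_distribution) AE_cdf_le_iff:
  assumes cont: "\<And>x. isCont (cdf M) x"
  shows "AE y in M. cdf M y \<le> cdf M x \<longleftrightarrow> y \<le> x"
proof -
  have [measurable]: "{y. cdf M y \<le> cdf M x} \<in> sets M"
    unfolding M_is_borel by measurable
  have sub: "{..x} \<subseteq> {y. cdf M y \<le> cdf M x}" using cdf_nondecreasing by auto
  then have "measure M ({y. cdf M y \<le> cdf M x} - {..x}) = 0"
    using measure_cdf_le_cdf[OF cont, of x] cdf_def2[of M x, symmetric]
    by (subst finite_measure_Diff) auto
  then have "AE y in M. y \<notin> {y. cdf M y \<le> cdf M x} - {..x}"
    by (subst (asm) prob_eq_0) auto
  then show ?thesis using sub by (auto elim: eventually_mono)
qed

lemma (in real_distribution) cdf_quantile: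
  assumes cont: "\<And>x. isCont (cdf M) x" and "0 < u" "u < 1"
  obtains x where "cdf M x = u"
proof -
  obtain a where a: "cdf M a < u"
    using order_tendstoD(2)[OF cdf_lim_at_bot \<open>0 < u\<close>] eventually_happens[of _ "at_bot :: real filter"] by auto
  obtain b where b: "u < cdf M b"
    using order_tendstoD(1)[OF cdf_lim_at_top_prob \<open>u < 1\<close>] eventually_happens[of _ "at_top :: real filter"] by auto
  have "a \<le> b" using a b cdf_nondecreasing[of b a] by (cases "a \<le> b") auto
  then show thesis using IVT[of "cdf M" a u b] a b cont that by auto
qed

lemma measure_uniform_atMost:
  assumes "0 \<le> c" "c \<le> 1"
  shows "measure (uniform_measure lborel {0..1::real}) {..c} = c"
proof -
  have "{0..1} \<inter> {..c} = {0..c}" using assms by auto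
  then show ?thesis using assms by (simp add: measure_lborel_Icc)
qed

lemma prob_space_uniform_01: "prob_space (uniform_measure lborel {0..1::real})"
  by (rule prob_space_uniform_measure) auto

text \<open>The probability integral transform. Levels strictly between 0 and 1 are attained by the
  intermediate value theorem; the others are handled by monotonicity and boundedness.\<close>

lemma (in real_distribution) distr_cdf_uniform:
  assumes cont: "\<And>x. isCont (cdf M) x"
  shows "distr M borel (cdf M) = uniform_measure lborel {0..1}"
proof (rule cdf_unique)
  interpret U: prob_space "uniform_measure lborel {0..1::real}" by (rule prob_space_uniform_01)
  show "real_distribution (uniform_measure lborel {0..1})"
    by unfold_locales simp_all
  show "real_distribution (distr M borel (cdf M))"
    by (rule real_distribution_distr) simp
  have L: "cdf (distr M borel (cdf M)) u = measure M {y. cdf M y \<le> u}" for u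
  proof -
    have "cdf (distr M borel (cdf M)) u = measure (distr M borel (cdf M)) {..u}" by (rule cdf_def2)
    also have "\<dots> = measure M {y. cdf M y \<le> u}" by (simp add: measure_distr vimage_def)
    finally show ?thesis .
  qed
  have mid: "measure M {y. cdf M y \<le> u} = u" if u: "0 < u" "u < 1" for u
  proof -
    obtain x where "cdf M x = u" using cdf_quantile[OF cont u] .
    then show ?thesis using measure_cdf_le_cdf[OF cont, of x] by simp
  qed
  have "measure M {y. cdf M y \<le> u} = measure (uniform_measure lborel {0..1}) {..u}" for u
  proof (cases "u \<le> 0")
    case True
    have "measure M {y. cdf M y \<le> u} \<le> v" if "0 < v" "v < 1" for v
    proof -
      have "{y. cdf M y \<le> v} \<in> sets M" unfolding M_is_borel by measurable
      then have "measure M {y. cdf M y \<le> u} \<le> measure M {y. cdf M y \<le> v}"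
        using True that by (intro finite_measure_mono) auto
      then show ?thesis using mid[OF that] by simp
    qed
    then have "measure M {y. cdf M y \<le> u} \<le> 0"
      by (intro dense_ge_bounded[of 0 1]) auto
    moreover have "measure (uniform_measure lborel {0..1}) {..u} \<le> measure (uniform_measure lborel {0..1}) {..0::real}"
      using True by (intro U.finite_measure_mono) auto
    then have "measure (uniform_measure lborel {0..1}) {..u} \<le> 0"
      using measure_uniform_atMost[of 0] by simp
    ultimately show ?thesis by (simp only: measure_le_0_iff)
  next
    case False
    show ?thesis
    proof (cases "u < 1")
      case True
      then show ?thesis using mid[of u] measure_uniform_atMost[of u] False by simp
    next
      case u: False
      then have "{y. cdf M y \<le> u} = UNIV" "{0..1} \<inter> {..u} = {0..1::real}"
        by (auto intro: order_trans[OF cdf_bounded_prob])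
      then show ?thesis using prob_space by simp
    qed
  qed
  then show "cdf (distr M borel (cdf M)) = cdf (uniform_measure lborel {0..1})"
    by (intro ext) (simp only: L cdf_def2[of "uniform_measure lborel {0..1}"])
qed

text \<open>The existence half of Sklar's theorem: the copula is the joint distribution function of
  the vector obtained by applying to each component its own distribution function.\<close>

lemma (in prob_space) copula_of_exists:
  fixes X :: "'a \<Rightarrow> real ^ 'n"
  assumes [measurable]: "X \<in> borel_measurable M"
    and cont: "\<And>i x. isCont (cdf (distr M borel (\<lambda>\<omega>. X \<omega> $ i))) x"
  shows "\<exists>C. copula_of M X C"
proof -
  define D where "D i = distr M borel (\<lambda>\<omega>. X \<omega> $ i)" for i
  define G where "G i = cdf (D i)" for i
  have rd: "real_distribution (D i)" for i
    unfolding D_def by (rule real_distribution_distr) simp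
  have cont': "isCont (cdf (D i)) x" for i x using cont by (simp add: D_def)
  have [measurable]: "G i \<in> borel_measurable borel" for i
    unfolding G_def by (rule real_distribution.cdf_measurable[OF rd])
  have G: "G i x = prob {\<omega> \<in> space M. X \<omega> $ i \<le> x}" for i x
  proof -
    have "(\<lambda>\<omega>. X \<omega> $ i) -` {..x} \<inter> space M = {\<omega> \<in> space M. X \<omega> $ i \<le> x}" by auto
    then show ?thesis by (simp add: G_def D_def cdf_def measure_distr)
  qed
  define N where "N = distr M borel (\<lambda>\<omega>. \<chi> i. G i (X \<omega> $ i))"
  define C where "C u = measure N {w. \<forall>i. w $ i \<le> u $ i}" for u :: "real ^ 'n"
  have "copula C"
    unfolding copula_def
  proof (intro exI[of _ N] conjI allI impI)
    show "prob_space N" unfolding N_def by (rule prob_space_distr) simp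
    show "distr N borel (\<lambda>w. w $ i) = uniform_measure lborel {0..1}" for i
    proof -
      have "distr N borel (\<lambda>w. w $ i) = distr (D i) borel (G i)"
        by (simp add: N_def D_def distr_distr comp_def)
      then show ?thesis
        unfolding G_def using real_distribution.distr_cdf_uniform[OF rd cont'] by simp
    qed
  qed (simp_all add: N_def C_def)
  moreover have "prob {\<omega> \<in> space M. \<forall>i. X \<omega> $ i \<le> x $ i}
      = C (\<chi> i. prob {\<omega> \<in> space M. X \<omega> $ i \<le> x $ i})" for x
  proof -
    have ae: "AE \<omega> in M. G i (X \<omega> $ i) \<le> G i (x $ i) \<longleftrightarrow> X \<omega> $ i \<le> x $ i" for i
    proof -
      have "AE y in D i. G i y \<le> G i (x $ i) \<longleftrightarrow> y \<le> x $ i"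
        unfolding G_def by (rule real_distribution.AE_cdf_le_iff[OF rd cont'])
      then show ?thesis unfolding D_def by (subst (asm) AE_distr_iff) auto
    qed
    then have "AE \<omega> in M. \<forall>i\<in>UNIV. G i (X \<omega> $ i) \<le> G i (x $ i) \<longleftrightarrow> X \<omega> $ i \<le> x $ i"
      by (intro AE_finite_allI) auto
    then have "prob {\<omega> \<in> space M. \<forall>i. X \<omega> $ i \<le> x $ i} = prob {\<omega> \<in> space M. \<forall>i. G i (X \<omega> $ i) \<le> G i (x $ i)}"
      by (intro finite_measure_eq_AE) (auto elim: eventually_mono)
    also have "\<dots> = measure N {w. \<forall>i. w $ i \<le> G i (x $ i)}"
    proof -
      have "{w :: real ^ 'n. \<forall>i. w $ i \<le> G i (x $ i)} \<in> sets borel" by measurable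
      moreover have "(\<lambda>\<omega>. \<chi> i. G i (X \<omega> $ i)) -` {w. \<forall>i. w $ i \<le> G i (x $ i)} \<inter> space M
          = {\<omega> \<in> space M. \<forall>i. G i (X \<omega> $ i) \<le> G i (x $ i)}" by auto
      ultimately show ?thesis unfolding N_def by (simp add: measure_distr)
    qed
    finally show ?thesis by (simp add: C_def G)
  qed
  ultimately show ?thesis unfolding copula_of_def by blast
qed

text \<open>An argument \<open>1\<close> need not be a value of a marginal distribution function, so the defining
  identity of a copula reaches such arguments only in the limit.\<close>

lemma (in prob_space) copula_of_eq:
  fixes X :: "'a \<Rightarrow> real ^ 'n"
  assumes [measurable]: "X \<in> borel_measurable M" and C: "copula_of M X C"
    and u: "\<And>i. i \<in> S \<Longrightarrow> u $ i = prob {\<omega> \<in> space M. X \<omega> $ i \<le> x i}" "\<And>i. i \<notin> S \<Longrightarrow> u $ i = 1"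
  shows "C u = prob {\<omega> \<in> space M. \<forall>i\<in>S. X \<omega> $ i \<le> x i}"
proof -
  obtain N where N: "prob_space N" and [measurable_cong]: "sets N = sets borel"
    and marg: "\<And>i. distr N borel (\<lambda>w. w $ i) = uniform_measure lborel {0..1}"
    and CN: "\<And>u. (\<forall>i. 0 \<le> u $ i \<and> u $ i \<le> 1) \<Longrightarrow> C u = measure N {w. \<forall>i. w $ i \<le> u $ i}"
    using C unfolding copula_of_def copula_def by auto
  interpret N: prob_space N by fact
  have spN: "space N = UNIV" using sets_eq_imp_space_eq[OF \<open>sets N = sets borel\<close>] by simp
  define F where "F i c = prob {\<omega> \<in> space M. X \<omega> $ i \<le> c}" for i c
  have F01: "0 \<le> F i c" "F i c \<le> 1" for i c by (simp_all add: F_def)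
  have F_lim: "(\<lambda>k. F i (real k)) \<longlonglongrightarrow> 1" for i
  proof -
    interpret D: real_distribution "distr M borel (\<lambda>\<omega>. X \<omega> $ i)" by (rule real_distribution_distr) simp
    have "(\<lambda>\<omega>. X \<omega> $ i) -` {..c} \<inter> space M = {\<omega> \<in> space M. X \<omega> $ i \<le> c}" for c by auto
    then show ?thesis
      using D.cdf_lim_infty D.prob_space by (simp add: cdf_def measure_distr F_def)
  qed
  have margN: "measure N {w. w $ i \<le> c} = c" if "0 \<le> c" "c \<le> 1" for i c
  proof -
    have "measure N {w. w $ i \<le> c} = measure (distr N borel (\<lambda>w. w $ i)) {..c}"
      by (simp add: measure_distr spN vimage_def)
    then show ?thesis using measure_uniform_atMost[OF that] by (simp only: marg)
  qed
  \<comment> \<open>Each argument 1 is approximated by the attained value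
    \<open>F i (real k)\<close>, so that the defining identity of the copula applies to
    \<open>u' k\<close>.\<close>
  define x' where "x' k = (\<chi> i. if i \<in> S then x i else real k)" for k
  define u' where "u' k = (\<chi> i. F i (x' k $ i))" for k
  define A where "A k = {\<omega> \<in> space M. \<forall>i. X \<omega> $ i \<le> x' k $ i}" for k
  have Cu': "C (u' k) = prob (A k)" for k
    using C unfolding copula_of_def u'_def A_def F_def by simp
  have "(\<lambda>k. prob (A k)) \<longlonglongrightarrow> prob (\<Union>k. A k)"
  proof (rule finite_Lim_measure_incseq)
    show "range A \<subseteq> sets M" unfolding A_def by auto
    show "incseq A" by (rule incseq_SucI) (auto simp: A_def x'_def split: if_splits intro: order_trans)
  qed
  also have "(\<Union>k. A k) = {\<omega> \<in> space M. \<forall>i\<in>S. X \<omega> $ i \<le> x i}"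
  proof (intro equalityI subsetI)
    fix \<omega> assume "\<omega> \<in> {\<omega> \<in> space M. \<forall>i\<in>S. X \<omega> $ i \<le> x i}"
    moreover obtain k where "norm (X \<omega>) \<le> real k" using real_arch_simple by blast
    then have "X \<omega> $ i \<le> real k" for i
      using component_le_norm_cart[of "X \<omega>" i] by linarith
    ultimately have "\<omega> \<in> A k" by (auto simp: A_def x'_def)
    then show "\<omega> \<in> (\<Union>k. A k)" by blast
  next
    fix \<omega> assume "\<omega> \<in> (\<Union>k. A k)"
    then obtain k where k: "\<omega> \<in> space M" "\<And>i. X \<omega> $ i \<le> x' k $ i" by (auto simp: A_def)
    have "X \<omega> $ i \<le> x i" if "i \<in> S" for i using k(2)[of i] that by (simp add: x'_def)
    then show "\<omega> \<in> {\<omega> \<in> space M. \<forall>i\<in>S. X \<omega> $ i \<le> x i}" using k(1) by simp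
  qed
  finally have lim1: "(\<lambda>k. C (u' k)) \<longlonglongrightarrow> prob {\<omega> \<in> space M. \<forall>i\<in>S. X \<omega> $ i \<le> x i}"
    by (simp add: Cu')
  have u01: "0 \<le> u $ i \<and> u $ i \<le> 1" for i using u[of i] by (cases "i \<in> S") auto
  have u'01: "0 \<le> u' k $ i \<and> u' k $ i \<le> 1" for k i using F01 by (simp add: u'_def)
  have low: "C (u' k) \<le> C u" for k
  proof -
    have "u' k $ i \<le> u $ i" for i using u[of i] F01 by (cases "i \<in> S") (auto simp: u'_def x'_def F_def)
    then show ?thesis
      unfolding CN[OF allI[OF u01]] CN[OF allI[OF u'01]]
      by (intro N.finite_measure_mono) (auto intro: order_trans)
  qed
  \<comment> \<open>Since the margins of \<open>N\<close> are uniform, lowering an argument from 1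
    to \<open>F i (real k)\<close> loses at most the difference; the union bound adds these
    losses.\<close>
  have up: "C u \<le> C (u' k) + (\<Sum>i\<in>UNIV. 1 - F i (real k))" for k
  proof -
    let ?B = "{w. \<forall>i. w $ i \<le> u' k $ i}" and ?E = "\<lambda>i. {w. \<not> w $ i \<le> F i (real k)}"
    have mB: "?B \<in> sets N" by measurable
    have mE: "?E i \<in> sets N" for i by measurable
    have E: "measure N (?E i) = 1 - F i (real k)" for i
      using N.prob_compl[of "{w. w $ i \<le> F i (real k)}"] margN[OF F01]
      by (simp add: spN Collect_neg_eq Compl_eq_Diff_UNIV)
    have "C u \<le> measure N (?B \<union> (\<Union>i\<in>UNIV. ?E i))"
      unfolding CN[OF allI[OF u01]]
    proof (intro N.finite_measure_mono subsetI)
      fix w assume "w \<in> {w. \<forall>i. w $ i \<le> u $ i}"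
      then have "w \<in> ?B" if "\<forall>i. w $ i \<le> F i (real k)"
        using that \<open>w \<in> {w. \<forall>i. w $ i \<le> u $ i}\<close> by (auto simp: u'_def x'_def F_def u(1)[symmetric])
      then show "w \<in> ?B \<union> (\<Union>i\<in>UNIV. ?E i)" by blast
    next
      show "?B \<union> (\<Union>i\<in>UNIV. ?E i) \<in> sets N" using mB mE by auto
    qed
    also have "\<dots> \<le> measure N ?B + measure N (\<Union>i\<in>UNIV. ?E i)"
      using mB mE by (intro measure_Un_le) auto
    also have "measure N (\<Union>i\<in>UNIV. ?E i) \<le> (\<Sum>i\<in>UNIV. measure N (?E i))"
      using mE by (intro measure_UNION_le) auto
    finally show ?thesis unfolding CN[OF allI[OF u'01]] E by simp
  qed
  have "(\<lambda>k. C (u' k) + (\<Sum>i\<in>UNIV. 1 - F i (real k)))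
      \<longlonglongrightarrow> prob {\<omega> \<in> space M. \<forall>i\<in>S. X \<omega> $ i \<le> x i} + (\<Sum>i\<in>(UNIV::'n set). 1 - 1)"
    by (intro tendsto_intros lim1 F_lim)
  then have "C u \<le> prob {\<omega> \<in> space M. \<forall>i\<in>S. X \<omega> $ i \<le> x i}"
    using up by (intro LIMSEQ_le_const) auto
  moreover have "prob {\<omega> \<in> space M. \<forall>i\<in>S. X \<omega> $ i \<le> x i} \<le> C u"
    using low by (intro LIMSEQ_le_const2[OF lim1]) auto
  ultimately show ?thesis by simp
qed

subsection \<open>Tail dependence\<close>

text \<open>This is the form in which invertibility of the covariance matrix
  \<open>A ** transpose A\<close> is used: it makes \<open>R\<close> positive definite and every row
  of \<open>A\<close> nonzero.\<close>

locale nondegenerate_normal_mixture = normal_mixture +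
  assumes transpose_injective: "transpose A *v w = 0 \<Longrightarrow> w = 0"
begin

definition \<sigma> :: "'b \<Rightarrow> real" where
  "\<sigma> i = norm (A $ i)"

definition R :: "real ^ 'b ^ 'b" where
  "R = (\<chi> i j. (A $ i \<bullet> A $ j) / (\<sigma> i * \<sigma> j))"

definition m :: "real ^ 'b" where
  "m = (\<chi> i. \<mu> $ i / \<sigma> i)"

text \<open>The change of variables from correlation coordinates, with \<open>R\<close> and
  \<open>m\<close>, to those of \<open>A\<close> and \<mu>: the form
  \<open>v \<bullet> (R *v v)\<close> becomes the squared norm of
  \<open>transpose A *v scaled v\<close>.\<close>

definition scaled :: "real ^ 'b \<Rightarrow> real ^ 'b" where
  "scaled v = (\<chi> i. v $ i / \<sigma> i)"

abbreviation "rate \<equiv> tail_rate \<theta> R m"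

definition weight :: "'b \<Rightarrow> real" where
  "weight i = sqrt (2 * \<theta> + (m $ i)\<^sup>2) - m $ i"

section \<open>Correlation coordinates and positivity\<close>

lemma weight_pos: "0 < weight i"
  unfolding weight_def using \<theta>_pos by (rule margin_weight_pos)

lemma transpose_mult_eq_sum: "transpose A *v w = (\<Sum>j\<in>UNIV. w $ j *\<^sub>R A $ j)"
  by (simp add: vec_eq_iff matrix_vector_mult_def transpose_def mult.commute del: transpose_matrix_vector)

lemma row_nonzero: "A $ i \<noteq> 0"
proof
  assume "A $ i = 0"
  have "transpose A *v axis i 1 = (\<Sum>j\<in>UNIV. if j = i then A $ i else 0)"
    unfolding transpose_mult_eq_sum by (rule sum.cong) (auto simp: axis_def)
  then have "transpose A *v axis i 1 = 0" using \<open>A $ i = 0\<close> by simp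
  from transpose_injective[OF this] show False by simp
qed

lemma \<sigma>_pos: "0 < \<sigma> i"
  by (simp add: \<sigma>_def row_nonzero)

lemma correlation_mult: "(R *v v) $ i = (A *v (transpose A *v scaled v)) $ i / \<sigma> i"
proof -
  have "(A *v (transpose A *v scaled v)) $ i = A $ i \<bullet> (\<Sum>j\<in>UNIV. scaled v $ j *\<^sub>R A $ j)"
    unfolding transpose_mult_eq_sum by (rule matrix_vector_mul_component)
  also have "\<dots> = (\<Sum>j\<in>UNIV. v $ j / \<sigma> j * (A $ i \<bullet> A $ j))"
    by (simp add: inner_sum_right scaled_def)
  finally show ?thesis
    by (simp add: R_def matrix_vector_mult_def sum_divide_distrib mult.commute)
qed

lemma correlation_form: "x \<bullet> (R *v y) = (transpose A *v scaled x) \<bullet> (transpose A *v scaled y)"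
proof -
  have "x \<bullet> (R *v y) = scaled x \<bullet> (A *v (transpose A *v scaled y))"
    by (simp add: inner_vec_def correlation_mult scaled_def del: transpose_matrix_vector)
  also have "\<dots> = (transpose A *v scaled x) \<bullet> (transpose A *v scaled y)"
    by (simp add: dot_lmul_matrix)
  finally show ?thesis .
qed

lemma correlation_pos:
  assumes "v \<noteq> 0"
  shows "0 < v \<bullet> (R *v v)"
proof -
  have "scaled v \<noteq> 0" using assms \<sigma>_pos by (auto simp: scaled_def vec_eq_iff less_imp_neq[symmetric])
  then have "transpose A *v scaled v \<noteq> 0" using transpose_injective by blast
  then show ?thesis unfolding correlation_form using inner_gt_zero_iff by blast
qed

lemma rate_pos:
  assumes "v \<noteq> 0"
  shows "0 < rate v"
proof -
  have "0 < 2 * \<theta> * (v \<bullet> (R *v v))" using \<theta>_pos correlation_pos[OF assms] by simp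
  from margin_weight_pos[of "\<theta> * (v \<bullet> (R *v v))" "m \<bullet> v"] this show ?thesis
    by (simp add: tail_rate_def mult.assoc)
qed

lemma tail_weights_weight:
  assumes "v \<in> tail_weights \<theta> m l"
  shows "(\<Sum>i\<in>UNIV. v $ i * (l $ i * weight i)) = 1"
  using assms by (simp add: tail_weights_def weight_def mult.assoc)

lemma tail_weights_nonzero:
  assumes "v \<in> tail_weights \<theta> m l"
  shows "v \<noteq> 0"
  using tail_weights_weight[OF assms] by auto

text \<open>The Lagrange multiplier of the large-deviation problem is the minimiser of the rate,
  rescaled so as to lie on the level set of \<open>exponent\<close>.\<close>

lemma orthant_limit_rate:
  fixes F :: "'u filter"
  assumes l: "l \<in> tail_directions"
    and v: "v \<in> tail_weights \<theta> m l" "\<And>w. w \<in> tail_weights \<theta> m l \<Longrightarrow> rate v \<le> rate w"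
    and t: "filterlim t at_top F"
    and x: "\<And>i. 0 < l $ i \<Longrightarrow> ((\<lambda>u. x u i / t u) \<longlongrightarrow> - (l $ i * weight i * \<sigma> i / (2 * \<theta>))) F"
  shows "((\<lambda>u. ln (prob (orthant {i. 0 < l $ i} (x u))) / t u) \<longlongrightarrow> - (1 / rate v)) F"
proof -
  let ?S = "{i. 0 < l $ i}"
  define h where "h = rate v"
  define q where "q = v \<bullet> (R *v v)"
  define D where "D = sqrt (2 * \<theta> * q + (m \<bullet> v)\<^sup>2)"
  \<comment> \<open>The factor \<open>2 * \<theta> / h\<close> is the positive root of the quadratic
    equation that puts the multiple of \<open>scaled v\<close> on the level set of
    \<open>exponent\<close>.\<close>
  define w where "w = (2 * \<theta> / h) *\<^sub>R scaled v"
  \<comment> \<open>The marginal quantile at level \<open>exp (- t * l $ i)\<close> is asymptotic to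
    \<open>- t * y i\<close>.\<close>
  define y where "y i = l $ i * weight i * \<sigma> i / (2 * \<theta>)" for i
  have v0: "v \<noteq> 0" by (rule tail_weights_nonzero[OF v(1)])
  have h: "0 < h" unfolding h_def by (rule rate_pos[OF v0])
  have q: "0 < q" unfolding q_def by (rule correlation_pos[OF v0])
  have "0 < 2 * \<theta> * q + (m \<bullet> v)\<^sup>2" using \<theta>_pos q by (intro add_pos_nonneg) auto
  then have D: "0 < D" "D\<^sup>2 = 2 * \<theta> * q + (m \<bullet> v)\<^sup>2" by (simp_all add: D_def)
  have hD: "h = D - m \<bullet> v" by (simp add: h_def tail_rate_def D_def q_def)
  \<comment> \<open>This eliminates \<open>q\<close> and \<open>m \<bullet> v\<close> in favour of
    \<open>h\<close> and \<open>D\<close>; the level-set and cost identities below become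
    elementary.\<close>
  have key: "2 * \<theta> * q = h * (2 * D - h)"
    using D(2) by (simp add: hD power2_eq_square algebra_simps)
  have nw: "(norm (transpose A *v w))\<^sup>2 = (2 * \<theta> / h)\<^sup>2 * q"
    unfolding w_def transpose_mult_scaleR q_def correlation_form norm_scaleR power_mult_distrib
    by (simp add: power2_norm_eq_inner power_divide del: transpose_matrix_vector)
  have w\<mu>: "w \<bullet> \<mu> = 2 * \<theta> / h * (m \<bullet> v)"
  proof -
    have "scaled v \<bullet> \<mu> = m \<bullet> v" by (simp add: scaled_def inner_vec_def m_def mult.commute)
    then show ?thesis by (simp add: w_def)
  qed
  have "(\<Sum>i\<in>?S. w $ i * y i) = (\<Sum>i\<in>?S. v $ i * (l $ i * weight i) / h)"
    using \<sigma>_pos \<theta>_pos by (intro sum.cong) (auto simp: w_def scaled_def y_def less_imp_neq[symmetric])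
  also have "\<dots> = (\<Sum>i\<in>UNIV. v $ i * (l $ i * weight i) / h)"
  proof (rule sum.mono_neutral_left)
    show "\<forall>i\<in>UNIV - ?S. v $ i * (l $ i * weight i) / h = 0"
    proof
      fix i assume "i \<in> UNIV - ?S"
      then have "l $ i = 0" using l by (auto simp: tail_directions_def not_less intro: antisym)
      then show "v $ i * (l $ i * weight i) / h = 0" by simp
    qed
  qed auto
  also have "\<dots> = 1 / h" by (simp add: sum_divide_distrib[symmetric] tail_weights_weight[OF v(1)])
  finally have V: "(\<Sum>i\<in>?S. w $ i * y i) = 1 / h" .
  have "((\<lambda>u. ln (prob (orthant ?S (x u))) / t u) \<longlongrightarrow> - (\<Sum>i\<in>?S. w $ i * y i)) F"
  \<comment> \<open>By \<open>key\<close>, \<theta> plus half the squared norm equals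
    \<open>2 * \<theta> * D / h\<close>; this value of \<open>s\<close> is the only one that makes
    the cost equal to \<open>1 / h\<close>.\<close>
  proof (rule orthant_limit[where s = "1 / (2 * \<theta> * D)"])
    have "exponent w = (2 * \<theta> / h)\<^sup>2 * q / 2 - 2 * \<theta> / h * (m \<bullet> v)"
      by (simp only: exponent_def nw w\<mu>)
    also have "\<dots> = \<theta> * (2 * \<theta> * q) / h\<^sup>2 - 2 * \<theta> / h * (D - h)"
      by (simp add: hD power2_eq_square)
    also have "\<dots> = \<theta>" unfolding key using h by (simp add: field_simps power2_eq_square)
    finally show "exponent w = \<theta>" .
    show "0 \<le> w $ i" for i
      using v(1) h \<theta>_pos \<sigma>_pos[of i] by (simp add: w_def scaled_def tail_weights_def)
    show "w $ i = 0" if "i \<notin> ?S" for i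
    proof -
      have "l $ i = 0" using that l by (auto simp: tail_directions_def not_less intro: antisym)
      then show ?thesis using v(1) by (simp add: w_def scaled_def tail_weights_def)
    qed
    show "0 < y i" if "i \<in> ?S" for i
      using that weight_pos[of i] \<sigma>_pos[of i] \<theta>_pos by (simp add: y_def)
    show "0 < 1 / (2 * \<theta> * D)" using \<theta>_pos D by simp
    show "y i \<le> 1 / (2 * \<theta> * D) * ((A *v (transpose A *v w)) $ i - \<mu> $ i)" if "i \<in> ?S" for i
    proof -
      have "h * (l $ i * weight i) * D \<le> 2 * \<theta> * (R *v v) $ i - h * m $ i"
        unfolding h_def weight_def D_def q_def
        using that by (intro tail_rate_minimiser_gradient v \<theta>_pos correlation_pos v0)
          (auto simp: correlation_form inner_commute)
      then have "\<sigma> i / (2 * \<theta> * D * h) * (h * (l $ i * weight i) * D)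
          \<le> \<sigma> i / (2 * \<theta> * D * h) * (2 * \<theta> * (R *v v) $ i - h * m $ i)"
        using \<sigma>_pos[of i] \<theta>_pos D h by (intro mult_left_mono) auto
      moreover have "\<sigma> i / (2 * \<theta> * D * h) * (h * (l $ i * weight i) * D) = y i"
        using D h by (simp add: y_def)
      moreover have "(A *v (transpose A *v w)) $ i = 2 * \<theta> / h * (\<sigma> i * (R *v v) $ i)"
        unfolding w_def transpose_mult_scaleR matrix_vector_mult_scaleR correlation_mult
        using \<sigma>_pos[of i] by simp
      moreover have "\<mu> $ i = \<sigma> i * m $ i" using \<sigma>_pos[of i] by (simp add: m_def)
      moreover have "1 / (2 * \<theta> * D) * (2 * \<theta> / h * (\<sigma> i * (R *v v) $ i) - \<sigma> i * m $ i)
          = \<sigma> i / (2 * \<theta> * D * h) * (2 * \<theta> * (R *v v) $ i - h * m $ i)"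
        using h D(1) \<theta>_pos by (simp add: field_simps)
      ultimately show ?thesis by (simp only:)
    qed
    have "1 / (2 * \<theta> * D) * (\<theta> + (2 * \<theta> / h)\<^sup>2 * q / 2) = 1 / (2 * D) * (1 + (2 * \<theta> * q) / h\<^sup>2)"
      using \<theta>_pos D h by (simp add: field_simps power2_eq_square)
    also have "\<dots> = 1 / h" unfolding key using D h by (simp add: field_simps power2_eq_square)
    finally show "1 / (2 * \<theta> * D) * (\<theta> + (norm (transpose A *v w))\<^sup>2 / 2) = (\<Sum>i\<in>?S. w $ i * y i)"
      unfolding V nw .
    show "filterlim t at_top F" by fact
    show "((\<lambda>u. x u i / t u) \<longlongrightarrow> - y i) F" if "i \<in> ?S" for i
      using x that by (simp add: y_def)
  qed
  then show ?thesis unfolding V h_def .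
qed

section \<open>Tails of single margins\<close>

definition margin_rate :: "'b \<Rightarrow> real" where
  "margin_rate i = 2 * \<theta> / (weight i * \<sigma> i)"

lemma margin_rate_pos: "0 < margin_rate i"
  using \<theta>_pos weight_pos \<sigma>_pos by (simp add: margin_rate_def)

lemma ln_cdf_marginal_limit: "((\<lambda>x. ln (cdf (marginal i) x) / x) \<longlongrightarrow> margin_rate i) at_bot"
proof -
  define l :: "real ^ 'b" where "l = axis i 1"
  define v where "v = axis i (1 / (l $ i * (sqrt (2 * \<theta> + (m $ i)\<^sup>2) - m $ i)))"
  have v_weight: "v = axis i (1 / weight i)" by (simp add: v_def l_def weight_def)
  have l: "l \<in> tail_directions" by (auto simp: l_def tail_directions_def axis_def)
  have S: "{j. 0 < l $ j} = {i}" by (auto simp: l_def axis_def)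
  have v: "v \<in> tail_weights \<theta> m l"
    unfolding v_def by (rule axis_in_tail_weights[OF \<theta>_pos]) (simp add: l_def)
  have unique: "w = v" if "w \<in> tail_weights \<theta> m l" for w
  proof -
    have zero: "w $ j = 0" if "j \<noteq> i" for j
      using that \<open>w \<in> tail_weights \<theta> m l\<close> by (auto simp: tail_weights_def l_def axis_def)
    have "(\<Sum>j\<in>UNIV. w $ j * (l $ j * weight j)) = (\<Sum>j\<in>UNIV. if j = i then w $ i * weight i else 0)"
      by (rule sum.cong) (auto simp: l_def axis_def)
    then have "w $ i * weight i = 1" using tail_weights_weight[OF that] by simp
    then have "w $ i = 1 / weight i" using weight_pos[of i] by (simp add: field_simps)
    with zero show ?thesis by (auto simp: v_weight vec_eq_iff axis_def)
  qed
  \<comment> \<open>The factors \<open>weight i\<close> in the constraint are normalised for exactly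
    this, so the decay is carried by \<open>margin_rate i\<close> alone.\<close>
  have "rate v = 1"
  proof -
    have "R $ i $ i = 1" using row_nonzero[of i]
      by (simp add: R_def \<sigma>_def power2_norm_eq_inner[symmetric] power2_eq_square)
    moreover have "(R *v v) $ i = R $ i $ i / weight i"
    proof -
      have "(R *v v) $ i = (\<Sum>j\<in>UNIV. if j = i then R $ i $ i / weight i else 0)"
        unfolding matrix_vector_mult_def vec_lambda_beta by (rule sum.cong) (auto simp: v_weight axis_def)
      then show ?thesis by simp
    qed
    ultimately have "v \<bullet> (R *v v) = 1 / (weight i)\<^sup>2"
      by (simp add: v_weight inner_axis' power2_eq_square)
    moreover have mv: "m \<bullet> v = m $ i / weight i" by (simp add: v_weight inner_axis)
    ultimately have "2 * \<theta> * (v \<bullet> (R *v v)) + (m \<bullet> v)\<^sup>2 = (2 * \<theta> + (m $ i)\<^sup>2) / (weight i)\<^sup>2"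
      by (simp add: power_divide add_divide_distrib)
    then have "rate v = (sqrt (2 * \<theta> + (m $ i)\<^sup>2) - m $ i) / weight i"
      using weight_pos[of i] by (simp add: tail_rate_def mv real_sqrt_divide diff_divide_distrib)
    then show ?thesis using weight_pos[of i] unfolding weight_def by simp
  qed
  \<comment> \<open>The scale \<open>- (margin_rate i * x)\<close> tends to infinity as
    \<open>x\<close> tends to minus infinity and makes \<open>x\<close> over the scale
    constant.\<close>
  have "((\<lambda>x. ln (prob (orthant {j. 0 < l $ j} ((\<lambda>x _. x) x))) / (- (margin_rate i * x))) \<longlongrightarrow> - (1 / rate v)) at_bot"
  proof (rule orthant_limit_rate[OF l v])
    show "rate v \<le> rate w" if "w \<in> tail_weights \<theta> m l" for w using unique[OF that] by simp
    show "filterlim (\<lambda>x. - (margin_rate i * x)) at_top at_bot"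
      using margin_rate_pos[of i] by real_asymp
    fix j assume "0 < l $ j"
    then have j: "j = i" using S by blast
    have "((\<lambda>x::real. - (1 / margin_rate i)) \<longlongrightarrow> - (1 / margin_rate i)) at_bot" by simp
    moreover have "\<forall>\<^sub>F x in at_bot. - (1 / margin_rate i) = x / (- (margin_rate i * x))"
      using eventually_gt_at_bot[of 0] by eventually_elim (use margin_rate_pos[of i] in \<open>simp add: field_simps\<close>)
    ultimately have "((\<lambda>x. x / (- (margin_rate i * x))) \<longlongrightarrow> - (1 / margin_rate i)) at_bot"
      by (rule Lim_transform_eventually)
    then show "((\<lambda>x. x / (- (margin_rate i * x))) \<longlongrightarrow> - (l $ j * weight j * \<sigma> j / (2 * \<theta>))) at_bot"
      by (simp add: j l_def margin_rate_def)
  qed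
  then have "((\<lambda>x. ln (cdf (marginal i) x) / (- (margin_rate i * x))) \<longlongrightarrow> - 1) at_bot"
    by (simp add: S \<open>rate v = 1\<close> cdf_marginal)
  then have "((\<lambda>x. - margin_rate i * (ln (cdf (marginal i) x) / (- (margin_rate i * x)))) \<longlongrightarrow> - margin_rate i * - 1) at_bot"
    by (intro tendsto_intros)
  then show ?thesis using margin_rate_pos[of i] by simp
qed

lemma copula_tail_limit:
  assumes l: "l \<in> tail_directions" and C: "copula_of M X C"
    and v: "v \<in> tail_weights \<theta> m l" "\<And>w. w \<in> tail_weights \<theta> m l \<Longrightarrow> rate v \<le> rate w"
  shows "((\<lambda>u. (MIN i. ln (u powr (l $ i))) / ln (C (\<chi> i. u powr (l $ i)))) \<longlongrightarrow> (MAX i. l $ i) * rate v) (at_right 0)"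
proof -
  let ?S = "{i. 0 < l $ i}"
  define L where "L = (MAX i. l $ i)"
  define t where "t u = - ln u" for u :: real
  \<comment> \<open>An arbitrary quantile suffices: every choice has the same asymptotics, so flat
    pieces of the distribution function do no harm.\<close>
  define x where "x u i = (SOME x. cdf (marginal i) x = u powr (l $ i))" for u i
  have t: "filterlim t at_top (at_right 0)"
    unfolding t_def using ln_at_0 by (simp add: filterlim_uminus_at_top)
  have u01: "\<forall>\<^sub>F u in at_right (0::real). 0 < u \<and> u < 1"
    using eventually_at_right_real[of 0 "1::real"] by simp
  have x: "cdf (marginal i) (x u i) = u powr (l $ i)" if "0 < u" "u < 1" "0 < l $ i" for u i
  proof -
    have "u powr (l $ i) < 1" "0 < u powr (l $ i)"
      using that by (auto simp: powr_def mult_less_0_iff)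
    then obtain z where "cdf (marginal i) z = u powr (l $ i)"
      using real_distribution.cdf_quantile[OF real_distribution_marginal isCont_cdf_marginal[OF row_nonzero]] by blast
    then show ?thesis unfolding x_def by (rule someI)
  qed
  have x_lim: "((\<lambda>u. x u i / t u) \<longlongrightarrow> - (l $ i * weight i * \<sigma> i / (2 * \<theta>))) (at_right 0)" if i: "0 < l $ i" for i
  proof -
    have "filterlim (\<lambda>u. x u i) at_bot (at_right 0)"
      unfolding filterlim_at_bot
    proof
      fix B
      have "((\<lambda>u. u powr (l $ i)) \<longlongrightarrow> 0) (at_right 0)" using i by real_asymp
      from order_tendstoD(2)[OF this cdf_marginal_pos[OF row_nonzero, of i B]] u01
      show "\<forall>\<^sub>F u in at_right 0. x u i \<le> B"
      proof eventually_elim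
        case (elim u)
        interpret D: real_distribution "marginal i" by (rule real_distribution_marginal)
        have "cdf (marginal i) (x u i) < cdf (marginal i) B" using x[of u i] elim i by simp
        then show ?case using D.cdf_nondecreasing[of B "x u i"] by (cases "x u i \<le> B") auto
      qed
    qed
    from filterlim_compose[OF ln_cdf_marginal_limit this]
    have "((\<lambda>u. - l $ i / (ln (cdf (marginal i) (x u i)) / x u i)) \<longlongrightarrow> - l $ i / margin_rate i) (at_right 0)"
      using margin_rate_pos[of i] by (intro tendsto_intros) auto
    \<comment> \<open>The logarithm of the marginal distribution function at its quantile is
      \<open>- l $ i * t u\<close>, which inverts the linear asymptotics of the margin.\<close>
    moreover have "\<forall>\<^sub>F u in at_right 0. - l $ i / (ln (cdf (marginal i) (x u i)) / x u i) = x u i / t u"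
      using u01 by eventually_elim (use i in \<open>simp add: x ln_powr t_def field_simps\<close>)
    ultimately have "((\<lambda>u. x u i / t u) \<longlongrightarrow> - l $ i / margin_rate i) (at_right 0)"
      by (rule Lim_transform_eventually)
    then show ?thesis by (simp add: margin_rate_def mult.assoc)
  qed
  have "((\<lambda>u. ln (prob (orthant ?S (x u))) / t u) \<longlongrightarrow> - (1 / rate v)) (at_right 0)"
    by (rule orthant_limit_rate[OF l v t x_lim])
  then have "((\<lambda>u. - L / (ln (prob (orthant ?S (x u))) / t u)) \<longlongrightarrow> - L / - (1 / rate v)) (at_right 0)"
    using rate_pos[OF tail_weights_nonzero[OF v(1)]] by (intro tendsto_intros) auto
  moreover have "\<forall>\<^sub>F u in at_right 0. - L / (ln (prob (orthant ?S (x u))) / t u)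
      = (MIN i. ln (u powr (l $ i))) / ln (C (\<chi> i. u powr (l $ i)))"
    using u01
  proof eventually_elim
    case (elim u)
    have "C (\<chi> i. u powr (l $ i)) = prob {\<omega> \<in> space M. \<forall>i\<in>?S. X \<omega> $ i \<le> x u i}"
    proof (rule copula_of_eq[OF X_measurable C])
      show "(\<chi> i. u powr (l $ i)) $ i = prob {\<omega> \<in> space M. X \<omega> $ i \<le> x u i}" if "i \<in> ?S" for i
        using x[of u i] elim that by (simp add: cdf_marginal orthant_def)
      show "(\<chi> i. u powr (l $ i)) $ i = 1" if "i \<notin> ?S" for i
      proof -
        have "l $ i = 0" using that l by (auto simp: tail_directions_def not_less intro: antisym)
        then show ?thesis using elim by simp
      qed
    qed
    \<comment> \<open>Since \<open>ln u\<close> is negative, the minimum belongs to the largest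
      \<open>l $ i\<close>.\<close>
    moreover have "(MIN i. ln (u powr (l $ i))) = L * ln u"
    proof -
      have "(MIN i. ln (u powr (l $ i))) = Min ((\<lambda>a. a * ln u) ` range (\<lambda>i. l $ i))"
        using elim by (simp add: image_image ln_powr)
      also have "\<dots> = L * ln u"
      proof (rule Min_eqI)
        fix a assume "a \<in> (\<lambda>a. a * ln u) ` range (\<lambda>i. l $ i)"
        then obtain i where "a = l $ i * ln u" by auto
        moreover have "l $ i \<le> L" by (simp add: L_def)
        ultimately show "L * ln u \<le> a" using elim by (simp add: mult_right_mono_neg)
      qed (auto simp: L_def intro: Max_in)
      finally show ?thesis .
    qed
    ultimately show ?case by (simp add: orthant_def t_def)
  qed
  ultimately have "((\<lambda>u. (MIN i. ln (u powr (l $ i))) / ln (C (\<chi> i. u powr (l $ i)))) \<longlongrightarrow>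
      - L / - (1 / rate v)) (at_right 0)"
    by (rule Lim_transform_eventually)
  moreover have "- L / - (1 / rate v) = L * rate v" by simp
  ultimately show ?thesis by (simp only: L_def)
qed

end

section \<open>From the hypotheses on \<open>Y\<close> and the density to the locale\<close>

lemma little_o_tail_bounds:
  fixes \<rho> r :: "real \<Rightarrow> real"
  assumes "r \<in> o[at_top](\<lambda>s. s)" "\<forall>\<^sub>F s in at_top. \<rho> s = exp (- \<theta> * s + r s)" "0 < \<epsilon>"
  shows "\<forall>\<^sub>F s in at_top. exp (- (\<theta> + \<epsilon>) * s) \<le> \<rho> s \<and> \<rho> s \<le> exp (- (\<theta> - \<epsilon>) * s)"
  using landau_o.smallD[OF assms(1,3)] assms(2) eventually_gt_at_top[of 0]
  by eventually_elim (auto simp: algebra_simps abs_le_iff)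

text \<open>Integrals of \<open>Y\<close> are transported to the standard normals. Centering removes
  the shift, and orthonormality of the coordinates reduces covariances to inner products of rows,
  which matches \<open>R\<close> and \<sigma> of the locale.\<close>

lemma gaussian_vector_moments:
  fixes Y :: "'a \<Rightarrow> real ^ 'n" and A :: "real ^ 'n ^ 'n"
  assumes "prob_space M" "Y \<in> borel_measurable M"
    and Y: "distr M borel Y = distr std_gauss borel (\<lambda>g. a + A *v (\<chi> i. g i))"
    and mean: "\<And>i. (LINT w|M. Y w $ i) = 0"
  shows "a = 0" "covariance_matrix M Y $ i $ j = A $ i \<bullet> A $ j"
proof -
  have Ag: "(A *v (\<chi> k. g k)) $ i = (\<Sum>k\<in>UNIV. A $ i $ k * g k)" for g :: "'n \<Rightarrow> real" and i
    by (simp add: matrix_vector_mult_def)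
  have transfer: "(LINT w|M. f (Y w)) = (LINT g|std_gauss. f (a + A *v (\<chi> i. g i)))"
    if [measurable]: "f \<in> borel_measurable borel" for f :: "real ^ 'n \<Rightarrow> real"
  proof -
    have "(LINT w|M. f (Y w)) = (LINT y|distr M borel Y. f y)"
      using assms(2) by (simp add: integral_distr)
    also have "\<dots> = (LINT g|std_gauss. f (a + A *v (\<chi> i. g i)))"
      unfolding Y by (simp add: integral_distr)
    finally show ?thesis .
  qed
  have "a $ i = 0" for i
  proof -
    have "0 = (LINT g|std_gauss. (a + A *v (\<chi> i. g i)) $ i)"
      using mean[of i] transfer[of "\<lambda>y. y $ i"] by simp
    also have "\<dots> = (LINT g|std_gauss. a $ i + (\<Sum>k\<in>UNIV. A $ i $ k * g k))"
      by (simp add: Ag)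
    also have "\<dots> = a $ i"
    proof -
      have "integrable std_gauss (\<lambda>g. \<Sum>k\<in>UNIV. A $ i $ k * g k)"
        by (intro Bochner_Integration.integrable_sum integrable_mult_right std_gauss_coord_moments(1))
      moreover have "(LINT g|std_gauss. (\<Sum>k\<in>UNIV. A $ i $ k * g k)) = 0"
        by (subst Bochner_Integration.integral_sum) (simp_all add: std_gauss_coord_moments)
      ultimately show ?thesis
        by (simp add: std_gauss.P.prob_space)
    qed
    finally show ?thesis by simp
  qed
  then show a: "a = 0" by (simp add: vec_eq_iff)
  have "covariance_matrix M Y $ i $ j = (LINT w|M. Y w $ i * Y w $ j)"
    by (simp add: covariance_matrix_def mean)
  also have "\<dots> = (LINT g|std_gauss. (\<Sum>k\<in>UNIV. \<Sum>l\<in>UNIV. A $ i $ k * A $ j $ l * (g k * g l)))"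
    using transfer[of "\<lambda>y. y $ i * y $ j"] by (simp add: a Ag sum_product ac_simps)
  also have "\<dots> = (\<Sum>k\<in>UNIV. \<Sum>l\<in>UNIV. A $ i $ k * A $ j $ l * of_bool (k = l))"
    by (simp add: Bochner_Integration.integral_sum std_gauss_coord_moments(3,4))
  also have "\<dots> = (\<Sum>k\<in>UNIV. \<Sum>l\<in>UNIV. if k = l then A $ i $ k * A $ j $ l else 0)"
    by (intro sum.cong) auto
  also have "\<dots> = A $ i \<bullet> A $ j" by (simp add: inner_vec_def)
  finally show "covariance_matrix M Y $ i $ j = A $ i \<bullet> A $ j" .
qed

theorem proposition3:
  fixes M :: "'a measure"
    and Y X :: "'a \<Rightarrow> real ^ 'n"
    and Z :: "'a \<Rightarrow> real"
    and \<mu> \<mu>' :: "real ^ 'n"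
    and R :: "real ^ 'n ^ 'n"
    and \<sigma> :: "'n \<Rightarrow> real"
    and \<rho> :: "real \<Rightarrow> real"
    and \<theta> :: real
    and h :: "real ^ 'n \<Rightarrow> real"
  assumes "prob_space M"
    and "gaussian_vector M Y"
    and "\<And>i. (LINT w|M. Y w $ i) = 0"
    and "invertible (covariance_matrix M Y)"
    and "AE w in M. 0 < Z w"
    and "prob_space.indep_set M
           (sets (vimage_algebra (space M) Z borel)) (sets (vimage_algebra (space M) Y borel))"
    and "\<And>s. 0 \<le> \<rho> s"
    and "distributed M lborel Z (\<lambda>s. ennreal (\<rho> s))"
    and "0 < \<theta>"
    and "\<exists>r. r \<in> o[at_top](\<lambda>s. s) \<and> (\<forall>\<^sub>F s in at_top. \<rho> s = exp (- \<theta> * s + r s))"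
  defines "R \<equiv> correlation_matrix M Y"
    and "\<sigma> \<equiv> \<lambda>i. sqrt (prob_space.variance M (\<lambda>w. Y w $ i))"
    and "\<mu>' \<equiv> \<chi> i. \<mu> $ i / \<sigma> i"
    and "X \<equiv> \<lambda>w. sqrt (Z w) *\<^sub>R Y w + Z w *\<^sub>R \<mu>"
    and "h \<equiv> \<lambda>v. sqrt (2 * \<theta> * (v \<bullet> (R *v v)) + (\<mu>' \<bullet> v)\<^sup>2) - \<mu>' \<bullet> v"
  shows "(\<forall>i. (\<lambda>x. ln (measure M {w \<in> space M. X w $ i \<le> x})) \<sim>[at_bot]
              (\<lambda>x. 2 * \<theta> / (sqrt (2 * \<theta> * (\<sigma> i)\<^sup>2 + (\<mu> $ i)\<^sup>2) - \<mu> $ i) * x))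
    \<and> (\<forall>l \<in> tail_directions. \<exists>v \<in> tail_weights \<theta> \<mu>' l. \<forall>w \<in> tail_weights \<theta> \<mu>' l. h v \<le> h w)
    \<and> (\<exists>C. copula_of M X C)
    \<and> (\<forall>C. copula_of M X C \<longrightarrow>
          has_weak_lower_tail_dependence C
            (\<lambda>l. (MAX i. l $ i) * (INF v \<in> tail_weights \<theta> \<mu>' l. h v)))"
proof -
  interpret prob_space M by fact
  obtain A :: "real ^ 'n ^ 'n" and a where Y: "Y \<in> borel_measurable M"
    "distr M borel Y = distr std_gauss borel (\<lambda>g. a + A *v (\<chi> i. g i))"
    using assms(2) unfolding gaussian_vector_def by auto
  note mom = gaussian_vector_moments[OF assms(1) Y assms(3)]
  have cov: "covariance_matrix M Y = A ** transpose A"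
    by (simp add: vec_eq_iff mom(2) matrix_matrix_mult_def transpose_def inner_vec_def)
  obtain r where r: "r \<in> o[at_top](\<lambda>s. s)" "\<forall>\<^sub>F s in at_top. \<rho> s = exp (- \<theta> * s + r s)"
    using assms(10) by blast
  interpret N: nondegenerate_normal_mixture M Y Z A \<mu> \<rho> \<theta>
  proof
    show "distr M borel Y = distr std_gauss borel (\<lambda>g. A *v (\<chi> i. g i))"
      using Y(2) mom(1) by simp
    show "\<forall>\<^sub>F s in at_top. exp (- (\<theta> + \<epsilon>) * s) \<le> \<rho> s" "\<forall>\<^sub>F s in at_top. \<rho> s \<le> exp (- (\<theta> - \<epsilon>) * s)"
      if "0 < \<epsilon>" for \<epsilon>
      using little_o_tail_bounds[OF r that] by (auto elim: eventually_mono)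
    show "w = 0" if "transpose A *v w = 0" for w
    proof -
      have "covariance_matrix M Y *v w = A *v (transpose A *v w)"
        unfolding cov by (simp only: matrix_vector_mul_assoc)
      also have "\<dots> = 0" using that by (simp only: matrix_vector_mult_0_right)
      finally show ?thesis
        using assms(4) by (metis invertible_def matrix_vector_mul_assoc matrix_vector_mul_lid matrix_vector_mult_0_right)
    qed
  qed (use Y(1) assms in auto)
  have X: "X = N.X" by (simp add: X_def N.X_def fun_eq_iff)
  have \<sigma>: "\<sigma> i = N.\<sigma> i" for i
  proof -
    have "variance (\<lambda>w. Y w $ i) = covariance_matrix M Y $ i $ i"
      by (simp add: covariance_matrix_def power2_eq_square)
    then show ?thesis by (simp add: \<sigma>_def N.\<sigma>_def mom(2) norm_eq_sqrt_inner)
  qed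
  have \<mu>': "\<mu>' = N.m" by (simp add: \<mu>'_def N.m_def \<sigma>)
  have "R = N.R"
    by (simp add: R_def N.R_def correlation_matrix_def mom(2) N.\<sigma>_def norm_eq_sqrt_inner)
  then have h: "h = N.rate" by (simp add: h_def tail_rate_def \<mu>' fun_eq_iff)
  have minimiser: "\<exists>v\<in>tail_weights \<theta> \<mu>' l. \<forall>w\<in>tail_weights \<theta> \<mu>' l. h v \<le> h w" if "l \<in> tail_directions" for l
    unfolding h \<mu>' using tail_rate_minimiser_exists[OF assms(9) that, of N.m N.R] by metis
  have "(\<lambda>x. ln (measure M {w \<in> space M. X w $ i \<le> x})) \<sim>[at_bot]
      (\<lambda>x. 2 * \<theta> / (sqrt (2 * \<theta> * (\<sigma> i)\<^sup>2 + (\<mu> $ i)\<^sup>2) - \<mu> $ i) * x)" for i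
  proof -
    \<comment> \<open>Pulling the standard deviation out of the root identifies the stated constant
      with \<open>margin_rate i\<close>.\<close>
    have "sqrt (2 * \<theta> * (\<sigma> i)\<^sup>2 + (\<mu> $ i)\<^sup>2) = sqrt ((2 * \<theta> + (N.m $ i)\<^sup>2) * (N.\<sigma> i)\<^sup>2)"
      using N.\<sigma>_pos[of i] by (simp add: \<sigma> N.m_def power_divide field_simps)
    then have "sqrt (2 * \<theta> * (\<sigma> i)\<^sup>2 + (\<mu> $ i)\<^sup>2) - \<mu> $ i = N.weight i * N.\<sigma> i"
      using N.\<sigma>_pos[of i] by (simp add: real_sqrt_mult N.weight_def N.m_def left_diff_distrib)
    then have rate: "2 * \<theta> / (sqrt (2 * \<theta> * (\<sigma> i)\<^sup>2 + (\<mu> $ i)\<^sup>2) - \<mu> $ i) = N.margin_rate i"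
      by (simp add: N.margin_rate_def)
    have "((\<lambda>x. ln (cdf (N.marginal i) x) / x / N.margin_rate i) \<longlongrightarrow> N.margin_rate i / N.margin_rate i) at_bot"
      using N.margin_rate_pos[of i] by (intro tendsto_intros N.ln_cdf_marginal_limit) simp
    then have "((\<lambda>x. ln (cdf (N.marginal i) x) / (N.margin_rate i * x)) \<longlongrightarrow> 1) at_bot"
      using N.margin_rate_pos[of i] by (simp add: mult.commute)
    then have "(\<lambda>x. ln (cdf (N.marginal i) x)) \<sim>[at_bot] (\<lambda>x. N.margin_rate i * x)"
      by (rule asymp_equivI')
    then show ?thesis unfolding rate by (simp add: N.cdf_marginal N.orthant_def X)
  qed
  moreover have "\<exists>C. copula_of M X C"
    unfolding X
    using N.isCont_cdf_marginal[OF N.row_nonzero] by (intro copula_of_exists N.X_measurable) (simp add: N.marginal_def)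
  moreover have "has_weak_lower_tail_dependence C (\<lambda>l. (MAX i. l $ i) * (INF v \<in> tail_weights \<theta> \<mu>' l. h v))"
    if C: "copula_of M X C" for C
    unfolding has_weak_lower_tail_dependence_def
  proof
    fix l :: "real ^ 'n" assume l: "l \<in> tail_directions"
    obtain v where v: "v \<in> tail_weights \<theta> \<mu>' l" "\<And>w. w \<in> tail_weights \<theta> \<mu>' l \<Longrightarrow> h v \<le> h w"
      using minimiser[OF l] by blast
    have "(INF v \<in> tail_weights \<theta> \<mu>' l. h v) = h v"
      using v by (intro cInf_eq_minimum) auto
    \<comment> \<open>The convention for \<open>C = 0\<close> agrees with the default values
      \<open>ln 0 = 0\<close> and division by zero, so the case distinction collapses.\<close>
    moreover have "(if C (\<chi> i. u powr (l $ i)) = 0 then 0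
        else (MIN i. ln (u powr (l $ i))) / ln (C (\<chi> i. u powr (l $ i))))
      = (MIN i. ln (u powr (l $ i))) / ln (C (\<chi> i. u powr (l $ i)))" for u
      by auto
    ultimately show "((\<lambda>u. if C (\<chi> i. u powr (l $ i)) = 0 then 0
        else (MIN i. ln (u powr (l $ i))) / ln (C (\<chi> i. u powr (l $ i))))
      \<longlongrightarrow> (MAX i. l $ i) * (INF v \<in> tail_weights \<theta> \<mu>' l. h v)) (at_right 0)"
      using N.copula_tail_limit[OF l C[unfolded X] v[unfolded h \<mu>']] by (simp only: h)
  qed
  ultimately show ?thesis using minimiser by blast
qed

end
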